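(* Let $\lambda\in\mathbb{R}$ and let $M_\lambda(x)=\sum_{n=0}^\infty m_n(\lambda)x^n$ be the moment generating function of the limit distribution of $S_N(\lambda)$, where $m_n(\lambda)=\lim_{N\to\infty}\varphi\big(S_N(\lambda)^n\big)$. Then, for all sufficiently small $x>0$, $$\frac{1}{M_\lambda(x)}=\lambda x+(1-\lambda x)\cdot T_0^{-1}\left(\frac12\ln\left(\frac{(1-\lambda x)^2}{(1-\lambda x)^2-2x^2}\right)\right).$$
   Context: Notation: $\mathbb{N}=\{0,1,2,\dots\}$, $[n]=\{1,\dots,n\}$. Operators. A finite word $(i_1,\dots,i_n)$ over $\mathbb{N}$ is a V-word if $n=0$ or there is $m\in[n]$ with $i_1>\dots>i_m<\dots<i_n$; let $\mathcal{V}$ be the set of V-words. The discrete V-monotone Fock space $\mathcal{F}$ is the complex Hilbert space with orthonormal basis $(e_w)_{w\in\mathcal V}$; $\Omega=e_{()}$ is the vacuum vector, and $e_w=0$ for words $w\notin\mathcal V$. For $i\in\mathbb{N}$ the bounded operators $A_i^+,A_i^-,A_i^\circ$ on $\mathcal F$ are determined by: $A_i^+e_w=e_{(i,w)}$ (concatenation) for $w\in\mathcal V$; $A_i^-\Omega=A_i^\circ\Omega=0$; and for $w=(j,w_0)\in\mathcal V$, $A_i^-e_w=\delta_{i,j}e_{w_0}$ and $A_i^\circ e_w=\delta_{i,j}e_w$. The vacuum state is $\varphi(b)=\langle b\,\Omega,\Omega\rangle$. For $N\ge1$ put $$S_N(\lambda)=\sum_{i=1}^N\Big(\frac{A_i^++A_i^-}{\sqrt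 N}+\lambda A_i^\circ\Big).$$ The function $T_0:[0,\infty)\to\mathbb{R}$ is $$T_0(s)=-\frac{\sqrt3}{3}\Big(\arctan\Big(\frac{2s-1}{\sqrt3}\Big)-\frac{\pi}{6}\Big)-\frac{\ln(s^2-s+1)}{2}=\int_s^1\frac{t}{t^2-t+1}\,dt .$$ It is strictly decreasing with range $(-\infty,\sqrt3\pi/9]$, and $T_0^{-1}:(-\infty,\sqrt3\pi/9]\to[0,\infty)$ is its inverse. *)

theory Defs
  imports "HOL-Analysis.Analysis"
begin

section \<open>V-words\<close>

definition V_word :: "nat list \<Rightarrow> bool" where
  "V_word w \<longleftrightarrow> w = [] \<or>
     (\<exists>m\<in>{1..length w}. sorted_wrt (>) (take m w) \<and> sorted_wrt (<) (drop (m - 1) w))"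

lemma V_word_Nil [simp]: "V_word []"
  by (simp add: V_word_def)

lemma V_word_ConsD: "V_word (i # w) \<Longrightarrow> V_word w"
proof (cases "w = []")
  case False
  assume "V_word (i # w)"
  then obtain m where m: "1 \<le> m" "m \<le> Suc (length w)"
    "sorted_wrt (>) (take m (i # w))" "sorted_wrt (<) (drop (m - 1) (i # w))"
    unfolding V_word_def by auto
  show "V_word w"
  proof (cases "m = 1")
    case True
    then have "sorted_wrt (>) (take 1 w) \<and> sorted_wrt (<) (drop (1 - 1) w)" "1 \<in> {1..length w}"
      using m False by (cases w; simp)+
    then show ?thesis
      unfolding V_word_def by blast
  next
    case False
    then have "m = Suc (Suc (m - 2))"
      using m(1) by simp
    then obtain k where k: "m = Suc (Suc k)" ..
    then have "sorted_wrt (>) (take (Suc k) w)" "sorted_wrt (<) (drop (Suc k - 1) w)"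
      "Suc k \<in> {1..length w}"
      using m by auto
    then show ?thesis
      unfolding V_word_def by blast
  qed
qed auto


section \<open>The discrete V-monotone Fock space\<close>

text \<open>The space is realised as the \<open>\<ell>\<^sup>2\<close> space over the V-words: square-summable complex functions
  on words that vanish off the V-words.\<close>

typedef fock = "{f :: nat list \<Rightarrow> complex.
    (\<forall>w. \<not> V_word w \<longrightarrow> f w = 0) \<and> (\<lambda>w. (cmod (f w))\<^sup>2) summable_on UNIV}"
  morphisms coord Abs_fock
  by (rule exI[of _ "\<lambda>_. 0"]) auto

setup_lifting type_definition_fock

lemma coord_off: "\<not> V_word w \<Longrightarrow> coord f w = 0"
  using coord[of f] by auto

lemma coord_summable: "(\<lambda>w. (cmod (coord f w))\<^sup>2) summable_on UNIV"
  using coord[of f] by auto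

lemma cmod_add_sq: "(cmod (a + b))\<^sup>2 \<le> 2 * (cmod a)\<^sup>2 + 2 * (cmod b)\<^sup>2"
proof -
  have "(cmod (a + b))\<^sup>2 \<le> (cmod a + cmod b)\<^sup>2"
    by (simp add: norm_triangle_ineq power_mono)
  also have "\<dots> \<le> 2 * (cmod a)\<^sup>2 + 2 * (cmod b)\<^sup>2"
    using sum_squares_bound[of "cmod a" "cmod b"] by (simp add: power2_sum)
  finally show ?thesis .
qed

lemma square_summable_add:
  assumes "(\<lambda>w. (cmod (f w))\<^sup>2) summable_on A" "(\<lambda>w. (cmod (g w))\<^sup>2) summable_on A"
  shows "(\<lambda>w. (cmod (f w + g w))\<^sup>2) summable_on A"
proof (rule summable_on_comparison_test)
  show "(\<lambda>w. 2 * (cmod (f w))\<^sup>2 + 2 * (cmod (g w))\<^sup>2) summable_on A"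
    using assms by (intro summable_on_add summable_on_cmult_right)
qed (auto intro: cmod_add_sq)

lemma square_summable_cmult:
  assumes "(\<lambda>w. (cmod (f w))\<^sup>2) summable_on A"
  shows "(\<lambda>w. (cmod (c * f w))\<^sup>2) summable_on A"
  unfolding norm_mult power_mult_distrib using assms by (intro summable_on_cmult_right)

lift_definition scaleC :: "complex \<Rightarrow> fock \<Rightarrow> fock" (infixr "*\<^sub>C" 75) is "\<lambda>c f w. c * f w"
  by (auto intro: square_summable_cmult)

instantiation fock :: real_vector
begin

lift_definition zero_fock :: fock is "\<lambda>_. 0"
  by simp
lift_definition plus_fock :: "fock \<Rightarrow> fock \<Rightarrow> fock" is "\<lambda>f g w. f w + g w"
  by (auto intro: square_summable_add)
lift_definition uminus_fock :: "fock \<Rightarrow> fock" is "\<lambda>f w. - f w"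
  by auto
definition minus_fock :: "fock \<Rightarrow> fock \<Rightarrow> fock" where
  "minus_fock f g = f + - g"
definition scaleR_fock :: "real \<Rightarrow> fock \<Rightarrow> fock" where
  "scaleR_fock r f = complex_of_real r *\<^sub>C f"

lemma coord_simps [simp]:
  "coord 0 w = 0" "coord (f + g) w = coord f w + coord g w"
  "coord (- f) w = - coord f w" "coord (f - g) w = coord f w - coord g w"
  "coord (c *\<^sub>C f) w = c * coord f w" "coord (r *\<^sub>R f) w = complex_of_real r * coord f w"
  by (simp_all add: zero_fock.rep_eq plus_fock.rep_eq uminus_fock.rep_eq minus_fock_def
      scaleC.rep_eq scaleR_fock_def)

lemma fock_eqI: "(\<And>w. coord f w = coord g w) \<Longrightarrow> f = g"
  by (simp add: coord_inject[symmetric] fun_eq_iff)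

instance
  by standard (rule fock_eqI; simp add: algebra_simps)+

end

lemma coord_sum [simp]: "coord (sum f A) w = (\<Sum>i\<in>A. coord (f i) w)"
  by (induction A rule: infinite_finite_induct) auto

text \<open>Linear in the first argument, as in \<open>\<phi>(b) = \<langle>b \<Omega>, \<Omega>\<rangle>\<close>.\<close>

definition cinner :: "fock \<Rightarrow> fock \<Rightarrow> complex" where
  "cinner f g = (\<Sum>\<^sub>\<infinity>w. coord f w * cnj (coord g w))"

lemma cinner_summable: "(\<lambda>w. coord f w * cnj (coord g w)) summable_on UNIV"
proof (rule Infinite_Sum.abs_summable_summable, rule Infinite_Sum.abs_summable_on_comparison_test')
  show "(\<lambda>w. (cmod (coord f w))\<^sup>2 + (cmod (coord g w))\<^sup>2) summable_on UNIV"
    by (intro summable_on_add coord_summable)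
  show "cmod (coord f w * cnj (coord g w)) \<le> (cmod (coord f w))\<^sup>2 + (cmod (coord g w))\<^sup>2" for w
  proof -
    have "0 \<le> cmod (coord f w) * cmod (coord g w)" by simp
    then show ?thesis
      using sum_squares_bound[of "cmod (coord f w)" "cmod (coord g w)"]
      unfolding norm_mult complex_mod_cnj by linarith
  qed
qed

lemma cinner_add_left: "cinner (f + g) h = cinner f h + cinner g h"
  unfolding cinner_def coord_simps distrib_right by (intro infsum_add cinner_summable)

lemma cinner_scaleC_left: "cinner (c *\<^sub>C f) g = c * cinner f g"
  unfolding cinner_def coord_simps mult.assoc by (intro infsum_cmult_right cinner_summable)

lemma cinner_commute: "cinner f g = cnj (cinner g f)"
  unfolding cinner_def infsum_cnj[symmetric] by (simp add: mult.commute)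

lemma cinner_self: "cinner f f = complex_of_real (\<Sum>\<^sub>\<infinity>w. (cmod (coord f w))\<^sup>2)"
proof -
  have "((\<lambda>w. complex_of_real ((cmod (coord f w))\<^sup>2)) has_sum
      complex_of_real (\<Sum>\<^sub>\<infinity>w. (cmod (coord f w))\<^sup>2)) UNIV"
    unfolding has_sum_of_real_iff by (rule has_sum_infsum[OF coord_summable])
  then show ?thesis
    unfolding cinner_def complex_norm_square[symmetric] by (rule infsumI)
qed

instantiation fock :: real_inner
begin

definition inner_fock :: "fock \<Rightarrow> fock \<Rightarrow> real" where
  "inner_fock f g = Re (cinner f g)"
definition norm_fock :: "fock \<Rightarrow> real" where
  "norm_fock f = sqrt (inner f f)"
definition dist_fock :: "fock \<Rightarrow> fock \<Rightarrow> real" where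
  "dist_fock f g = norm (f - g)"
definition sgn_fock :: "fock \<Rightarrow> fock" where
  "sgn_fock f = inverse (norm f) *\<^sub>R f"
definition "(uniformity :: (fock \<times> fock) filter) =
  (INF e\<in>{0<..}. principal {(f, g). dist f g < e})"
definition "open (U :: fock set) \<longleftrightarrow>
  (\<forall>x\<in>U. \<forall>\<^sub>F (x', y) in uniformity. x' = x \<longrightarrow> y \<in> U)"

instance
proof
  fix x y z :: fock and r :: real
  show "inner x y = inner y x"
    unfolding inner_fock_def by (subst cinner_commute) simp
  show "inner (x + y) z = inner x z + inner y z"
    by (simp add: inner_fock_def cinner_add_left)
  show "inner (r *\<^sub>R x) y = r * inner x y"
    by (simp add: inner_fock_def scaleR_fock_def cinner_scaleC_left)
  show "0 \<le> inner x x"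
    by (simp add: inner_fock_def cinner_self infsum_nonneg)
  show "inner x x = 0 \<longleftrightarrow> x = 0"
  proof
    assume "inner x x = 0"
    then have "(cmod (coord x w))\<^sup>2 = 0" for w
      using nonneg_infsum_le_0D[OF _ coord_summable, of x w]
      by (simp add: inner_fock_def cinner_self)
    then show "x = 0"
      by (intro fock_eqI) simp
  qed (simp add: inner_fock_def cinner_self)
qed (simp_all add: dist_fock_def norm_fock_def sgn_fock_def uniformity_fock_def open_fock_def)

end

lemma norm_fock_sq: "(norm f)\<^sup>2 = (\<Sum>\<^sub>\<infinity>w. (cmod (coord f w))\<^sup>2)"
  by (simp add: power2_norm_eq_inner inner_fock_def cinner_self)

lemma sum_coord_le: "finite F \<Longrightarrow> (\<Sum>w\<in>F. (cmod (coord f w))\<^sup>2) \<le> (norm f)\<^sup>2"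
  unfolding norm_fock_sq by (intro finite_sum_le_infsum coord_summable) auto

lemma norm_coord_le: "cmod (coord f w) \<le> norm f"
  using sum_coord_le[of "{w}" f] by (auto intro: power2_le_imp_le)

instance fock :: complete_space
proof
  fix X :: "nat \<Rightarrow> fock"
  assume X: "Cauchy X"
  have "Cauchy (\<lambda>n. coord (X n) w)" for w
    unfolding Cauchy_def
  proof (intro allI impI)
    fix e :: real assume "0 < e"
    then obtain M where M: "\<And>m n. m \<ge> M \<Longrightarrow> n \<ge> M \<Longrightarrow> dist (X m) (X n) < e"
      using X unfolding Cauchy_def by blast
    have "dist (coord (X m) w) (coord (X n) w) < e" if "m \<ge> M" "n \<ge> M" for m n
      using M[OF that] norm_coord_le[of "X m - X n" w] by (simp add: dist_norm)
    then show "\<exists>M. \<forall>m\<ge>M. \<forall>n\<ge>M. dist (coord (X m) w) (coord (X n) w) < e"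
      by blast
  qed
  then have "\<forall>w. \<exists>l. (\<lambda>n. coord (X n) w) \<longlonglongrightarrow> l"
    by (simp add: Cauchy_convergent convergent_def[symmetric])
  then obtain l where l: "\<And>w. (\<lambda>n. coord (X n) w) \<longlonglongrightarrow> l w"
    by metis
  have fin: "(\<Sum>w\<in>F. (cmod (coord (X m) w - l w))\<^sup>2) \<le> e\<^sup>2"
    if M: "\<And>n. n \<ge> M \<Longrightarrow> dist (X m) (X n) < e" and "finite F" for F m M e
  proof (rule tendsto_upperbound)
    show "(\<lambda>n. \<Sum>w\<in>F. (cmod (coord (X m) w - coord (X n) w))\<^sup>2)
        \<longlonglongrightarrow> (\<Sum>w\<in>F. (cmod (coord (X m) w - l w))\<^sup>2)"
      by (intro tendsto_intros l)
    have "(\<Sum>w\<in>F. (cmod (coord (X m) w - coord (X n) w))\<^sup>2) \<le> e\<^sup>2" if "n \<ge> M" for n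
    proof -
      have "(\<Sum>w\<in>F. (cmod (coord (X m) w - coord (X n) w))\<^sup>2) \<le> (norm (X m - X n))\<^sup>2"
        using sum_coord_le[OF \<open>finite F\<close>, of "X m - X n"] by simp
      also have "\<dots> \<le> e\<^sup>2"
        using M[OF that] by (intro power_mono) (auto simp: dist_norm)
      finally show ?thesis .
    qed
    then show "\<forall>\<^sub>F n in sequentially. (\<Sum>w\<in>F. (cmod (coord (X m) w - coord (X n) w))\<^sup>2) \<le> e\<^sup>2"
      using eventually_sequentially by blast
  qed simp
  have summ: "(\<lambda>w. (cmod (coord (X m) w - l w))\<^sup>2) summable_on UNIV"
    if "\<And>n. n \<ge> M \<Longrightarrow> dist (X m) (X n) < e" for m M e
    using fin[OF that] by (intro nonneg_bdd_above_summable_on) (auto intro!: bdd_aboveI)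
  obtain M1 where M1: "\<And>m n. m \<ge> M1 \<Longrightarrow> n \<ge> M1 \<Longrightarrow> dist (X m) (X n) < 1"
    using X unfolding Cauchy_def by (meson zero_less_one)
  have "(\<lambda>w. (cmod (coord (X M1) w + (-1) * (coord (X M1) w - l w)))\<^sup>2) summable_on UNIV"
    by (intro square_summable_add square_summable_cmult coord_summable summ[of M1 M1 1] M1) auto
  then have "(\<lambda>w. (cmod (l w))\<^sup>2) summable_on UNIV"
    by simp
  moreover have "l w = 0" if "\<not> V_word w" for w
    using l[of w] coord_off[OF that] by (simp add: LIMSEQ_const_iff)
  ultimately have "coord (Abs_fock l) = l"
    by (intro Abs_fock_inverse) auto
  then obtain L where L: "coord L = l" ..
  have "X \<longlonglongrightarrow> L"
  proof (rule metric_LIMSEQ_I)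
    fix e :: real assume "0 < e"
    then obtain M where M: "\<And>m n. m \<ge> M \<Longrightarrow> n \<ge> M \<Longrightarrow> dist (X m) (X n) < e / 2"
      using X unfolding Cauchy_def by (meson half_gt_zero)
    have "dist (X m) L < e" if "m \<ge> M" for m
    proof -
      have "(norm (X m - L))\<^sup>2 \<le> (e / 2)\<^sup>2"
        unfolding norm_fock_sq coord_simps L
        by (intro infsum_le_finite_sums summ[of M m "e / 2"] fin[of M m "e / 2"] M that)
      then have "norm (X m - L) \<le> e / 2"
        using \<open>0 < e\<close> by (auto intro: power2_le_imp_le)
      then show ?thesis
        using \<open>0 < e\<close> by (simp add: dist_norm)
    qed
    then show "\<exists>M. \<forall>m\<ge>M. dist (X m) L < e"
      by blast
  qed
  then show "convergent X"
    by (auto simp: convergent_def)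
qed


section \<open>The orthonormal basis\<close>

lift_definition ket :: "nat list \<Rightarrow> fock" is
  "\<lambda>w v. if V_word w \<and> v = w then 1 else 0"
proof -
  fix w :: "nat list"
  have "(\<lambda>v. (cmod (if V_word w \<and> v = w then 1 else 0))\<^sup>2) summable_on UNIV"
    by (rule finite_nonzero_values_imp_summable_on, rule finite_subset[of _ "{w}"]) auto
  then show "?thesis w" by auto
qed

lemma coord_ket: "coord (ket w) v = (if V_word w \<and> v = w then 1 else 0)"
  by (simp add: ket.rep_eq)

lemma ket_eq_0: "\<not> V_word w \<Longrightarrow> ket w = 0"
  by (intro fock_eqI) (simp add: coord_ket)

lemma cinner_ket: "V_word w \<Longrightarrow> cinner f (ket w) = coord f w"
proof -
  assume w: "V_word w"
  have "cinner f (ket w) = (\<Sum>\<^sub>\<infinity>v\<in>{w}. coord f v)"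
    unfolding cinner_def by (rule infsum_cong_neutral) (auto simp: coord_ket w)
  then show ?thesis by simp
qed

lemma ket_orthonormal:
  "V_word v \<Longrightarrow> V_word w \<Longrightarrow> cinner (ket v) (ket w) = (if v = w then 1 else 0)"
  by (simp add: cinner_ket coord_ket)

lemma ket_expansion: "((\<lambda>w. coord f w *\<^sub>C ket w) has_sum f) UNIV"
proof -
  let ?S = "\<lambda>F. \<Sum>w\<in>F. coord f w *\<^sub>C ket w"
  have c: "coord (?S F) v = (if v \<in> F then coord f v else 0)" if "finite F" for F v
  proof -
    have "coord (?S F) v = (\<Sum>w\<in>F. if v = w then coord f v else 0)"
      unfolding coord_sum coord_simps
      by (rule sum.cong) (auto simp: coord_ket coord_off)
    then show ?thesis using that by simp
  qed
  have n: "(norm (?S F - f))\<^sup>2 = (norm f)\<^sup>2 - (\<Sum>w\<in>F. (cmod (coord f w))\<^sup>2)" if F: "finite F" for F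
  proof -
    let ?g = "\<lambda>w. (cmod (coord f w))\<^sup>2"
    have "(norm (?S F - f))\<^sup>2 = infsum ?g (UNIV - F)"
      unfolding norm_fock_sq unfolding coord_simps(4)
      by (rule infsum_cong_neutral) (auto simp: c[OF F] simp del: coord_sum)
    also have "\<dots> = infsum ?g UNIV - infsum ?g F"
      using F by (intro infsum_Diff coord_summable) auto
    finally show ?thesis using F by (simp add: norm_fock_sq)
  qed
  have "((\<lambda>F. sqrt ((norm f)\<^sup>2 - (\<Sum>w\<in>F. (cmod (coord f w))\<^sup>2))) \<longlongrightarrow> sqrt ((norm f)\<^sup>2 - (norm f)\<^sup>2))
      (finite_subsets_at_top UNIV)"
    unfolding norm_fock_sq by (intro tendsto_intros infsum_tendsto coord_summable)
  moreover have "\<forall>\<^sub>F F in finite_subsets_at_top UNIV.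
      sqrt ((norm f)\<^sup>2 - (\<Sum>w\<in>F. (cmod (coord f w))\<^sup>2)) = norm (?S F - f)"
    by (intro eventually_finite_subsets_at_top_weakI) (metis n norm_ge_zero real_sqrt_abs abs_of_nonneg)
  ultimately have "((\<lambda>F. norm (?S F - f)) \<longlongrightarrow> 0) (finite_subsets_at_top UNIV)"
    by (simp add: tendsto_cong)
  then show ?thesis
    unfolding has_sum_def by (simp add: tendsto_norm_zero_iff LIM_zero_iff)
qed


section \<open>Bounded operators determined by their values on the basis\<close>

definition bounded_clinear :: "(fock \<Rightarrow> fock) \<Rightarrow> bool" where
  "bounded_clinear T \<longleftrightarrow> bounded_linear T \<and> (\<forall>c f. T (c *\<^sub>C f) = c *\<^sub>C T f)"

lemma bounded_clinear_eqI:
  assumes S: "bounded_clinear S" and T: "bounded_clinear T"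
    and ST: "\<And>w. V_word w \<Longrightarrow> S (ket w) = T (ket w)"
  shows "S = T"
proof
  fix f
  have *: "((\<lambda>w. coord f w *\<^sub>C U (ket w)) has_sum U f) UNIV" if "bounded_clinear U" for U
    using has_sum_bounded_linear[OF _ ket_expansion[of f], of U] that
    by (simp add: bounded_clinear_def o_def)
  have "coord f w *\<^sub>C S (ket w) = coord f w *\<^sub>C T (ket w)" for w
  proof (cases "V_word w")
    case False
    then show ?thesis by (intro fock_eqI) (simp add: coord_off)
  qed (simp add: ST)
  then show "S f = T f"
    using *[OF S] *[OF T] by (metis (no_types, lifting) has_sum_cong has_sum_unique)
qed

lemma bounded_clinearI:
  assumes "\<And>f g. T (f + g) = T f + T g" "\<And>c f. T (c *\<^sub>C f) = c *\<^sub>C T f"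
    "\<And>f. (norm (T f))\<^sup>2 \<le> (norm f)\<^sup>2"
  shows "bounded_clinear T"
  unfolding bounded_clinear_def
  using assms power2_le_imp_le[OF assms(3)]
  by (auto intro!: bounded_linear_intro[where K = 1] simp: scaleR_fock_def)

lemma summable_on_Cons:
  assumes "(g :: nat list \<Rightarrow> real) summable_on UNIV"
  shows "(\<lambda>w. g (i # w)) summable_on UNIV"
proof -
  have "g summable_on range ((#) i)"
    using assms by (rule summable_on_subset_banach) auto
  then show ?thesis
    by (subst (asm) summable_on_reindex) (auto simp: inj_on_def o_def)
qed

text \<open>In the following three definitions the operators are given by their matrix elements.
  The lemmas after them state that they are exactly the bounded operators with the prescribed
  values on the basis.\<close>

lift_definition A_plus :: "nat \<Rightarrow> fock \<Rightarrow> fock" is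
  "\<lambda>i f w. case w of [] \<Rightarrow> 0 | j # v \<Rightarrow> if j = i \<and> V_word w then f v else 0"
proof -
  fix i :: nat and f :: "nat list \<Rightarrow> complex"
  assume f: "(\<forall>w. \<not> V_word w \<longrightarrow> f w = 0) \<and> (\<lambda>w. (cmod (f w))\<^sup>2) summable_on UNIV"
  let ?h = "\<lambda>w. case w of [] \<Rightarrow> 0 | j # v \<Rightarrow> if j = i \<and> V_word w then f v else 0"
  have "(\<lambda>w. (cmod (f (tl w)))\<^sup>2) summable_on range ((#) i)"
    using f by (subst summable_on_reindex) (auto simp: inj_on_def o_def)
  then have "(\<lambda>w. (cmod (?h w))\<^sup>2) summable_on range ((#) i)"
    by (rule summable_on_comparison_test) auto
  then have "(\<lambda>w. (cmod (?h w))\<^sup>2) summable_on UNIV"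
    by (rule summable_on_cong_neutral[THEN iffD1, rotated -1]) (auto split: list.split)
  then show "?thesis i f"
    by (auto split: list.split)
qed

lift_definition A_minus :: "nat \<Rightarrow> fock \<Rightarrow> fock" is "\<lambda>i f w. f (i # w)"
proof -
  fix i :: nat and f :: "nat list \<Rightarrow> complex"
  assume f: "(\<forall>w. \<not> V_word w \<longrightarrow> f w = 0) \<and> (\<lambda>w. (cmod (f w))\<^sup>2) summable_on UNIV"
  then have "(\<lambda>w. (cmod (f (i # w)))\<^sup>2) summable_on UNIV"
    by (rule summable_on_Cons[where g = "\<lambda>w. (cmod (f w))\<^sup>2", OF conjunct2])
  with f show "?thesis i f"
    using V_word_ConsD by blast
qed

lift_definition A_circ :: "nat \<Rightarrow> fock \<Rightarrow> fock" is
  "\<lambda>i f w. if w \<noteq> [] \<and> hd w = i then f w else 0"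
proof -
  fix i :: nat and f :: "nat list \<Rightarrow> complex"
  assume f: "(\<forall>w. \<not> V_word w \<longrightarrow> f w = 0) \<and> (\<lambda>w. (cmod (f w))\<^sup>2) summable_on UNIV"
  then have "(\<lambda>w. (cmod (if w \<noteq> [] \<and> hd w = i then f w else 0))\<^sup>2) summable_on UNIV"
    by - (rule summable_on_comparison_test[of "\<lambda>w. (cmod (f w))\<^sup>2"], auto)
  with f show "?thesis i f" by auto
qed

lemma A_plus_ket: "V_word w \<Longrightarrow> A_plus i (ket w) = ket (i # w)"
  by (intro fock_eqI) (auto simp: A_plus.rep_eq coord_ket split: list.split)

lemma A_minus_vacuum: "A_minus i (ket []) = 0"
  by (intro fock_eqI) (auto simp: A_minus.rep_eq coord_ket)

lemma A_minus_ket: "V_word (j # w) \<Longrightarrow> A_minus i (ket (j # w)) = (if i = j then ket w else 0)"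
  by (intro fock_eqI) (auto simp: A_minus.rep_eq coord_ket dest: V_word_ConsD)

lemma A_circ_vacuum: "A_circ i (ket []) = 0"
  by (intro fock_eqI) (auto simp: A_circ.rep_eq coord_ket)

lemma A_circ_ket: "V_word (j # w) \<Longrightarrow> A_circ i (ket (j # w)) = (if i = j then ket (j # w) else 0)"
  by (intro fock_eqI) (auto simp: A_circ.rep_eq coord_ket)

lemma bounded_clinear_A_plus: "bounded_clinear (A_plus i)"
proof (rule bounded_clinearI)
  fix f
  show "(norm (A_plus i f))\<^sup>2 \<le> (norm f)\<^sup>2"
    unfolding norm_fock_sq[of "A_plus i f"]
  proof (rule infsum_le_finite_sums[OF coord_summable])
    fix F :: "nat list set" assume F: "finite F"
    have "(\<Sum>w\<in>F. (cmod (coord (A_plus i f) w))\<^sup>2)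
        \<le> (\<Sum>w\<in>F \<inter> range ((#) i). (cmod (coord f (tl w)))\<^sup>2)"
      unfolding sum.inter_restrict[OF F]
      by (intro sum_mono) (auto simp: A_plus.rep_eq split: list.split)
    also have "\<dots> = (\<Sum>w\<in>tl ` (F \<inter> range ((#) i)). (cmod (coord f w))\<^sup>2)"
      by (subst sum.reindex) (auto simp: inj_on_def)
    also have "\<dots> \<le> (norm f)\<^sup>2"
      using F by (intro sum_coord_le) auto
    finally show "(\<Sum>w\<in>F. (cmod (coord (A_plus i f) w))\<^sup>2) \<le> (norm f)\<^sup>2" .
  qed
qed (rule fock_eqI, auto simp: A_plus.rep_eq split: list.split)+

lemma bounded_clinear_A_minus: "bounded_clinear (A_minus i)"
proof (rule bounded_clinearI)
  fix f
  show "(norm (A_minus i f))\<^sup>2 \<le> (norm f)\<^sup>2"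
    unfolding norm_fock_sq[of "A_minus i f"]
  proof (rule infsum_le_finite_sums[OF coord_summable])
    fix F :: "nat list set" assume F: "finite F"
    have "(\<Sum>w\<in>F. (cmod (coord (A_minus i f) w))\<^sup>2) = (\<Sum>w\<in>(#) i ` F. (cmod (coord f w))\<^sup>2)"
      by (subst sum.reindex) (auto simp: inj_on_def A_minus.rep_eq)
    also have "\<dots> \<le> (norm f)\<^sup>2"
      using F by (intro sum_coord_le) auto
    finally show "(\<Sum>w\<in>F. (cmod (coord (A_minus i f) w))\<^sup>2) \<le> (norm f)\<^sup>2" .
  qed
qed (rule fock_eqI, simp add: A_minus.rep_eq)+

lemma bounded_clinear_A_circ: "bounded_clinear (A_circ i)"
proof (rule bounded_clinearI)
  fix f
  show "(norm (A_circ i f))\<^sup>2 \<le> (norm f)\<^sup>2"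
    unfolding norm_fock_sq
    by (intro infsum_mono coord_summable) (auto simp: A_circ.rep_eq)
qed (rule fock_eqI, simp add: A_circ.rep_eq)+

lemma A_plus_unique:
  "T = A_plus i \<longleftrightarrow> bounded_clinear T \<and> (\<forall>w. V_word w \<longrightarrow> T (ket w) = ket (i # w))"
  using bounded_clinear_eqI[of T "A_plus i"] bounded_clinear_A_plus A_plus_ket by auto

lemma A_minus_unique:
  "T = A_minus i \<longleftrightarrow> bounded_clinear T \<and> T (ket []) = 0 \<and>
     (\<forall>j w. V_word (j # w) \<longrightarrow> T (ket (j # w)) = (if i = j then ket w else 0))"
proof (intro iffI conjI)
  assume *: "bounded_clinear T \<and> T (ket []) = 0 \<and>
     (\<forall>j w. V_word (j # w) \<longrightarrow> T (ket (j # w)) = (if i = j then ket w else 0))"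
  then have "T (ket w) = A_minus i (ket w)" if "V_word w" for w
    using that by (cases w) (auto simp: A_minus_vacuum A_minus_ket)
  with * show "T = A_minus i"
    by (intro bounded_clinear_eqI bounded_clinear_A_minus) auto
qed (simp_all add: bounded_clinear_A_minus A_minus_vacuum A_minus_ket)

lemma A_circ_unique:
  "T = A_circ i \<longleftrightarrow> bounded_clinear T \<and> T (ket []) = 0 \<and>
     (\<forall>j w. V_word (j # w) \<longrightarrow> T (ket (j # w)) = (if i = j then ket (j # w) else 0))"
proof (intro iffI conjI)
  assume *: "bounded_clinear T \<and> T (ket []) = 0 \<and>
     (\<forall>j w. V_word (j # w) \<longrightarrow> T (ket (j # w)) = (if i = j then ket (j # w) else 0))"
  then have "T (ket w) = A_circ i (ket w)" if "V_word w" for w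
    using that by (cases w) (auto simp: A_circ_vacuum A_circ_ket)
  with * show "T = A_circ i"
    by (intro bounded_clinear_eqI bounded_clinear_A_circ) auto
qed (simp_all add: bounded_clinear_A_circ A_circ_vacuum A_circ_ket)


section \<open>Vacuum state, limit moments and their generating function\<close>

abbreviation vacuum :: fock ("\<Omega>") where
  "\<Omega> \<equiv> ket []"

definition vacuum_state :: "(fock \<Rightarrow> fock) \<Rightarrow> complex" ("\<phi>") where
  "\<phi> b = cinner (b \<Omega>) \<Omega>"

definition S_op :: "nat \<Rightarrow> real \<Rightarrow> fock \<Rightarrow> fock" where
  "S_op N lam f =
     (\<Sum>i = 1..N. (1 / sqrt (real N)) *\<^sub>R (A_plus i f + A_minus i f) + lam *\<^sub>R A_circ i f)"

definition limit_moment :: "real \<Rightarrow> nat \<Rightarrow> complex" where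
  "limit_moment lam n = lim (\<lambda>N. \<phi> (S_op N lam ^^ n))"

definition moment_gf :: "real \<Rightarrow> real \<Rightarrow> complex" where
  "moment_gf lam x = (\<Sum>n. limit_moment lam n * complex_of_real x ^ n)"


section \<open>The function \<open>T\<^sub>0\<close> and its inverse\<close>

definition T0 :: "real \<Rightarrow> real" where
  "T0 s = - (sqrt 3 / 3) * (arctan ((2 * s - 1) / sqrt 3) - pi / 6) - ln (s\<^sup>2 - s + 1) / 2"

definition T0_inv :: "real \<Rightarrow> real" where
  "T0_inv = the_inv_into {0..} T0"

lemma T0_quadratic_pos: "(s::real)\<^sup>2 - s + 1 > 0"
proof -
  have "s\<^sup>2 - s + 1 = (s - 1 / 2)\<^sup>2 + 3 / 4"
    by (simp add: power2_eq_square algebra_simps)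
  then show ?thesis
    by (metis add_nonneg_pos zero_le_power2 zero_less_divide_iff zero_less_numeral)
qed

lemma T0_deriv: "(T0 has_real_derivative - (s / (s\<^sup>2 - s + 1))) (at s within A)"
proof -
  let ?q = "s\<^sup>2 - s + 1"
  have q: "1 + ((2 * s - 1) / sqrt 3)\<^sup>2 = 4 / 3 * ?q"
    by (simp add: power_divide power2_eq_square field_simps)
  have "((\<lambda>s. arctan ((2 * s - 1) / sqrt 3)) has_real_derivative
      inverse (1 + ((2 * s - 1) / sqrt 3)\<^sup>2) * (2 / sqrt 3)) (at s within A)"
    by (rule DERIV_chain2[OF DERIV_arctan], rule DERIV_cdivide) (auto intro!: derivative_eq_intros)
  moreover have "((\<lambda>s. ln (s\<^sup>2 - s + 1)) has_real_derivative (2 * s - 1) / ?q) (at s within A)"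
    using T0_quadratic_pos[of s] by (auto intro!: derivative_eq_intros)
  ultimately have "(T0 has_real_derivative
      - (sqrt 3 / 3) * (inverse (4 / 3 * ?q) * (2 / sqrt 3) - 0) - (2 * s - 1) / ?q / 2)
      (at s within A)"
    unfolding T0_def q by (intro DERIV_diff DERIV_cmult DERIV_cdivide DERIV_const)
  moreover have "- (sqrt 3 / 3) * (inverse (4 / 3 * ?q) * (2 / sqrt 3) - 0) - (2 * s - 1) / ?q / 2
      = - (s / ?q)"
  proof -
    have "- (sqrt 3 / 3) * (inverse (4 / 3 * Q) * (2 / sqrt 3) - 0) - (2 * s - 1) / Q / 2
        = - (s / Q)" if "Q > 0" for Q
      using that by (simp add: field_simps)
    then show ?thesis using T0_quadratic_pos by blast
  qed
  ultimately show ?thesis by simp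
qed

lemma T0_continuous: "continuous_on A T0"
  by (rule DERIV_continuous_on, rule T0_deriv)

lemma T0_1: "T0 1 = 0"
proof -
  have "arctan (1 / sqrt 3) = pi / 6"
    using arctan_tan[of "pi / 6"] by (simp add: tan_30)
  then show ?thesis by (simp add: T0_def)
qed

lemma T0_0: "T0 0 = sqrt 3 * pi / 9"
proof -
  have "arctan (1 / sqrt 3) = pi / 6"
    using arctan_tan[of "pi / 6"] by (simp add: tan_30)
  then have "arctan (- 1 / sqrt 3) = - pi / 6"
    using arctan_minus[of "1 / sqrt 3"] by simp
  then show ?thesis by (simp add: T0_def)
qed

lemma T0_integral:
  assumes "0 \<le> s" "s \<le> 1"
  shows "((\<lambda>t. t / (t\<^sup>2 - t + 1)) has_integral T0 s) {s..1}"
proof -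
  have "((\<lambda>t. t / (t\<^sup>2 - t + 1)) has_integral (- T0 1 - - T0 s)) {s..1}"
    using assms(2)
    by (intro fundamental_theorem_of_calculus)
      (auto intro!: derivative_eq_intros T0_deriv
        simp: has_real_derivative_iff_has_vector_derivative[symmetric])
  then show ?thesis by (simp add: T0_1)
qed

lemma T0_strict_decreasing:
  assumes "0 \<le> s" "s < t"
  shows "T0 t < T0 s"
proof (rule DERIV_neg_imp_decreasing_open[OF assms(2)])
  fix x assume "s < x" "x < t"
  then show "\<exists>y. DERIV T0 x :> y \<and> y < 0"
    using T0_deriv[of x UNIV] T0_quadratic_pos[of x] assms
    by (intro exI[of _ "- (x / (x\<^sup>2 - x + 1))"]) auto
qed (rule T0_continuous)

lemma T0_inj: "inj_on T0 {0..}"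
  by (rule linorder_inj_onI) (auto dest: T0_strict_decreasing)

lemma T0_range: "T0 ` {0..} = {..sqrt 3 * pi / 9}"
proof (intro equalityI subsetI)
  fix y assume "y \<in> T0 ` {0..}"
  then obtain s where "s \<ge> 0" "y = T0 s" by auto
  then show "y \<in> {..sqrt 3 * pi / 9}"
    using T0_strict_decreasing[of 0 s] by (cases "s = 0") (auto simp: T0_0)
next
  fix y assume y: "y \<in> {..sqrt 3 * pi / 9}"
  define s where "s = 2 + exp (4 + 2 * \<bar>y\<bar>)"
  have "T0 s \<le> y"
  proof -
    have "exp (4 + 2 * \<bar>y\<bar>) \<le> s\<^sup>2 - s + 1"
    proof -
      have "s * 1 \<le> s * (s - 1)"
        by (intro mult_left_mono) (auto simp: s_def add_nonneg_nonneg)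
      then show ?thesis by (simp add: s_def power2_eq_square algebra_simps)
    qed
    then have l: "4 + 2 * \<bar>y\<bar> \<le> ln (s\<^sup>2 - s + 1)"
      using T0_quadratic_pos ln_ge_iff by blast
    have a: "- (sqrt 3 / 3) * (arctan ((2 * s - 1) / sqrt 3) - pi / 6) \<le> 2"
    proof -
      have "sqrt 3 / 3 \<le> (1::real)"
        using real_sqrt_le_mono[of 3 9] by simp
      moreover have "0 \<le> arctan ((2 * s - 1) / sqrt 3)"
        by (simp add: s_def add_nonneg_nonneg)
      moreover have "pi / 6 \<le> 2" using pi_less_4 by simp
      ultimately have "pi / 6 - arctan ((2 * s - 1) / sqrt 3) \<le> 2" by linarith
      then have "sqrt 3 / 3 * (pi / 6 - arctan ((2 * s - 1) / sqrt 3)) \<le> sqrt 3 / 3 * 2"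
        by (intro mult_left_mono) auto
      also have "\<dots> \<le> 2" using \<open>sqrt 3 / 3 \<le> 1\<close> by simp
      finally show ?thesis by (simp add: algebra_simps)
    qed
    show ?thesis unfolding T0_def using l a by linarith
  qed
  moreover have "y \<le> T0 0" using y by (simp add: T0_0)
  moreover have "0 \<le> s" by (simp add: s_def add_nonneg_nonneg)
  ultimately obtain x where "0 \<le> x" "T0 x = y"
    using IVT2'[of T0 s y 0] T0_continuous by blast
  then show "y \<in> T0 ` {0..}" by auto
qed

lemma T0_inv_T0: "0 \<le> s \<Longrightarrow> T0_inv (T0 s) = s"
  unfolding T0_inv_def using the_inv_into_f_f[OF T0_inj] by auto

lemma T0_T0_inv: "y \<le> sqrt 3 * pi / 9 \<Longrightarrow> 0 \<le> T0_inv y \<and> T0 (T0_inv y) = y"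
  unfolding T0_inv_def using the_inv_into_into[OF T0_inj, of y "{0..}"]
    f_the_inv_into_f[OF T0_inj, of y] by (auto simp: T0_range)

end

theory Submission
  imports Defs
begin

text \<open>
  On the span of the words with letters in \<open>{1..N}\<close> the operators \<open>A_circ i\<close> sum to the projection off
  the vacuum, so \<open>S_op N lam\<close> is the weighted adjacency operator of the tree of V-words (parent of
  \<open>i # w\<close>: \<open>w\<close>) with weight \<open>lam\<close> on every vertex but the root. Its moment series is the root entry
  of the resolvent, which on a tree is a continued fraction: the resolvent of the subtree above
  a vertex is determined by those above its children. Which letters may be put in front of a
  V-word depends only on its first letter \<open>i\<close> and on whether the word is rising (strictly increasing); hence there are
  just two families of subtrees. With \<open>a = 1 - lam * x\<close> and \<open>h = x\<^sup>2 / N\<close>, the reciprocals of their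
  resolvents satisfy
  \<open>E i = a - h * (\<Sum>k>i. 1 / E k)\<close> for words that are not rising and
  \<open>V i = E i - h * (\<Sum>k<i. 1 / V k)\<close> for rising ones.

  As \<open>N\<close> grows with \<open>i / N = t\<close> this becomes \<open>E' = x\<^sup>2 / E\<close>, \<open>V' = x\<^sup>2 * (1 / E - 1 / V)\<close> on \<open>[0, 1]\<close>
  with \<open>E(1) = a\<close> and \<open>V(0) = E(0)\<close>, and the moment series tends to \<open>1 / (lam * x + V(1))\<close>. The
  system has the first integrals \<open>E\<^sup>2 - 2 * x\<^sup>2 * t\<close> and \<open>T0 (V / E) - ln E\<close>. The former gives
  \<open>E(0)\<^sup>2 = a\<^sup>2 - 2 * x\<^sup>2\<close>, the latter \<open>T0 (V(1) / a) = ln (a / E(0))\<close>, which is the asserted formula.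

  The limit is taken on the recursion itself. For finite \<open>N\<close> each first integral deviates by \<open>O(h\<^sup>2)\<close> per step from
  its exact law (\<open>E_square_drift\<close>, \<open>first_integral_drift\<close>), hence by \<open>O(1 / N)\<close> in all. So the moment series converge pointwise for
  small \<open>x > 0\<close>. The moments are bounded by \<open>(2 + \<bar>lam\<bar>) ^ n\<close> uniformly in \<open>N\<close>, and therefore
  pointwise convergence of the series forces convergence of every moment
  (\<open>coefficients_convergent\<close>) and identifies the series of the limits (\<open>power_series_limit\<close>).
\<close>

section \<open>Prepending a letter to a V-word\<close>

lemma V_word_increasing: "sorted_wrt (<) w \<Longrightarrow> V_word w"
  unfolding V_word_def by (cases w) (auto intro!: bexI[of _ 1])

text \<open>The recursive form of the definition: a V-word with a letter in front is rising, or the letter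
  continues the descent.\<close>

lemma V_word_Cons_iff:
  "V_word (i # w) \<longleftrightarrow> sorted_wrt (<) (i # w) \<or> V_word w \<and> (w \<noteq> [] \<longrightarrow> hd w < i)"
proof
  assume V: "V_word (i # w)"
  then obtain m where m: "1 \<le> m" "m \<le> Suc (length w)"
    "sorted_wrt (>) (take m (i # w))" "sorted_wrt (<) (drop (m - 1) (i # w))"
    unfolding V_word_def by auto
  show "sorted_wrt (<) (i # w) \<or> V_word w \<and> (w \<noteq> [] \<longrightarrow> hd w < i)"
  proof (cases "m = 1")
    case False
    then have "m = Suc (Suc (m - 2))"
      using m(1) by simp
    then obtain k where "m = Suc (Suc k)" ..
    with m(3) have "w \<noteq> [] \<longrightarrow> hd w < i"
      by (cases w) auto
    then show ?thesis
      using V V_word_ConsD by blast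
  qed (use m in auto)
next
  assume "sorted_wrt (<) (i # w) \<or> V_word w \<and> (w \<noteq> [] \<longrightarrow> hd w < i)"
  then show "V_word (i # w)"
  proof
    assume V: "V_word w \<and> (w \<noteq> [] \<longrightarrow> hd w < i)"
    show ?thesis
    proof (cases w)
      case Nil
      then show ?thesis by (simp add: V_word_increasing)
    next
      case (Cons j v)
      with V obtain m where m: "1 \<le> m" "m \<le> length w"
        "sorted_wrt (>) (take m w)" "sorted_wrt (<) (drop (m - 1) w)"
        unfolding V_word_def by auto
      have "\<forall>y\<in>set (take m w). y < i"
        using m(1,3) V Cons by (cases m) auto
      then have "sorted_wrt (>) (take (Suc m) (i # w))"
        using m(3) by simp
      moreover have "sorted_wrt (<) (drop (Suc m - 1) (i # w))"
        using m(1,4) by (cases m) auto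
      ultimately show ?thesis
        unfolding V_word_def using m(2) by (intro disjI2 bexI[of _ "Suc m"]) auto
    qed
  qed (rule V_word_increasing)
qed

text \<open>A rising word can still turn into either kind of word; once a word begins with a descent, only
  larger letters may be prepended. These two cases are the two kinds of vertices of the tree.\<close>

lemma V_word_Cons_rising:
  assumes "sorted_wrt (<) (j # v)"
  shows "V_word (i # j # v) \<longleftrightarrow> i \<noteq> j"
proof -
  have "\<forall>k\<in>set v. j < k" using assms by simp
  then show ?thesis
    using assms V_word_increasing[OF assms] by (auto simp: V_word_Cons_iff[of i] neq_iff dest: less_trans)
qed

lemma V_word_Cons_falling:
  assumes "V_word (j # v)" "\<not> sorted_wrt (<) (j # v)"
  shows "V_word (i # j # v) \<longleftrightarrow> j < i"
  using assms by (auto simp: V_word_Cons_iff[of i])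

section \<open>The moments as iterates of a walk operator on words\<close>

text \<open>The operator \<open>S_op N lam\<close> after conjugation with the diagonal operator with entries
  \<open>sqrt N ^ length w\<close>. The contribution of the children becomes an average over letters, so the
  operator is bounded for the supremum norm uniformly in \<open>N\<close>.\<close>

definition walk_op :: "nat \<Rightarrow> real \<Rightarrow> (nat list \<Rightarrow> real) \<Rightarrow> nat list \<Rightarrow> real" where
  "walk_op N lam g w =
     (if V_word w
      then (if w \<noteq> [] \<and> hd w \<in> {1..N} then g (tl w) + lam * g w else 0)
        + (\<Sum>i=1..N. g (i # w)) / real N
      else 0)"

definition vac :: "nat list \<Rightarrow> real" where
  "vac w = (if w = [] then 1 else 0)"

abbreviation walk_moment :: "nat \<Rightarrow> real \<Rightarrow> nat \<Rightarrow> real" where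
  "walk_moment N lam n \<equiv> (walk_op N lam ^^ n) vac []"

lemma coord_S_op:
  "coord (S_op N lam f) w = (\<Sum>i=1..N.
     (coord (A_plus i f) w + coord (A_minus i f) w) / sqrt (real N)
      + lam * coord (A_circ i f) w)"
  by (simp add: S_op_def divide_inverse mult.commute)

text \<open>Creation reads the coordinate of the shorter word \<open>tl w\<close>, where the scaling is smaller by a factor
  \<open>sqrt N\<close> and cancels the weight \<open>1 / sqrt N\<close>; annihilation reads those of the longer words \<open>i # w\<close>,
  where scaling and weight combine to \<open>1 / N\<close>.\<close>

lemma coord_S_op_scaled:
  assumes N: "N > 0"
    and f: "\<And>w. coord f w = complex_of_real (g w / sqrt (real N) ^ length w)"
  shows "coord (S_op N lam f) w
      = complex_of_real (walk_op N lam g w / sqrt (real N) ^ length w)"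
proof (cases "V_word w")
  case False
  then show ?thesis by (simp add: coord_off walk_op_def)
next
  case V: True
  have sq: "complex_of_real (sqrt (real N)) * complex_of_real (sqrt (real N)) = of_nat N"
    by (metis of_nat_0_le_iff of_real_mult of_real_of_nat_eq real_sqrt_mult_self abs_of_nat)
  have up: "coord (A_minus i f) w / sqrt (real N)
      = complex_of_real (g (i # w) / real N / sqrt (real N) ^ length w)" for i
    using N by (simp add: A_minus.rep_eq f sq mult.assoc[symmetric] mult.commute mult.left_commute)
  show ?thesis
  proof (cases w)
    case Nil
    have "coord (S_op N lam f) w = (\<Sum>i=1..N. coord (A_minus i f) w / sqrt (real N))"
      unfolding coord_S_op by (simp add: Nil A_plus.rep_eq A_circ.rep_eq)
    also have "\<dots> = complex_of_real (walk_op N lam g w / sqrt (real N) ^ length w)"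
      unfolding up by (simp add: walk_op_def Nil sum_divide_distrib)
    finally show ?thesis .
  next
    case (Cons j v)
    have "coord (S_op N lam f) w
        = (\<Sum>i=1..N. if i = j then coord f v / sqrt (real N) + lam * coord f w else 0)
          + (\<Sum>i=1..N. coord (A_minus i f) w / sqrt (real N))"
      unfolding coord_S_op sum.distrib[symmetric]
      using V by (intro sum.cong) (auto simp: Cons A_plus.rep_eq A_circ.rep_eq add_divide_distrib)
    also have "(\<Sum>i=1..N. if i = j then coord f v / sqrt (real N) + lam * coord f w else 0)
        = complex_of_real ((if j \<in> {1..N} then g v + lam * g w else 0) / sqrt (real N) ^ length w)"
      by (simp add: f Cons sum.delta field_simps)
    finally show ?thesis
      unfolding up using V
      by (simp add: walk_op_def Cons sum_divide_distrib add_divide_distrib)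
  qed
qed

lemma walk_op_combination:
  "walk_op N lam (\<lambda>w. (\<Sum>k<n. c k * g k w) + b * f w) w
     = (\<Sum>k<n. c k * walk_op N lam (g k) w) + b * walk_op N lam f w"
proof -
  define s where "s g = (\<Sum>i=1..N. g (i # w)) / real N" for g :: "nat list \<Rightarrow> real"
  have div: "((\<Sum>k<n. c k * u k) + b * t) / r = (\<Sum>k<n. c k * (u k / r)) + b * (t / r)"
    for u t and r :: real
    by (simp add: add_divide_distrib sum_divide_distrib)
  have eq: "(\<Sum>i=1..N. (\<Sum>k<n. c k * g k (i # w)) + b * f (i # w))
      = (\<Sum>k<n. c k * (\<Sum>i=1..N. g k (i # w))) + b * (\<Sum>i=1..N. f (i # w))"
    unfolding sum.distrib sum_distrib_left by (subst sum.swap) (rule refl)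
  have s: "s (\<lambda>w. (\<Sum>k<n. c k * g k w) + b * f w) = (\<Sum>k<n. c k * s (g k)) + b * s f"
    unfolding s_def eq by (rule div)
  show ?thesis
  proof (cases "w \<noteq> [] \<and> hd w \<in> {1..N}")
    case True
    then have op: "walk_op N lam g w = (if V_word w then g (tl w) + lam * g w + s g else 0)" for g
      by (auto simp: walk_op_def s_def)
    have "lam * (\<Sum>k<n. c k * g k w) = (\<Sum>k<n. c k * (lam * g k w))"
      unfolding sum_distrib_left by (simp only: mult.left_commute)
    then show ?thesis
      unfolding op s by (auto simp: distrib_left sum.distrib)
  next
    case False
    then have "walk_op N lam g w = (if V_word w then s g else 0)" for g
      by (auto simp: walk_op_def s_def)
    then show ?thesis by (simp add: s)
  qed
qed

text \<open>The three terms contribute \<open>1\<close> (parent), \<open>\<bar>lam\<bar>\<close> (the vertex itself) and \<open>1\<close> (average over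
  children).\<close>

lemma walk_op_bound:
  assumes "\<And>w. \<bar>g w\<bar> \<le> B"
  shows "\<bar>walk_op N lam g w\<bar> \<le> (2 + \<bar>lam\<bar>) * B"
proof -
  have B: "0 \<le> B" using assms[of "[]"] by linarith
  define s where "s = (\<Sum>i=1..N. g (i # w)) / real N"
  have "\<bar>\<Sum>i=1..N. g (i # w)\<bar> \<le> (\<Sum>i=1..N. B)"
    by (rule order_trans[OF sum_abs sum_mono]) (rule assms)
  then have s: "\<bar>s\<bar> \<le> B"
    using B by (cases "N = 0") (auto simp: s_def abs_divide field_simps)
  have "\<bar>lam * g w\<bar> \<le> \<bar>lam\<bar> * B"
    unfolding abs_mult by (intro mult_left_mono assms) simp
  moreover have "0 \<le> \<bar>lam\<bar> * B" using B by simp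
  moreover have "(2 + \<bar>lam\<bar>) * B = 2 * B + \<bar>lam\<bar> * B"
    by (rule distrib_right)
  ultimately show ?thesis
    unfolding walk_op_def s_def[symmetric] using s B assms[of "tl w"] by auto
qed

lemma walk_op_power_bound:
  assumes "\<And>w. \<bar>g w\<bar> \<le> B"
  shows "\<bar>(walk_op N lam ^^ n) g w\<bar> \<le> (2 + \<bar>lam\<bar>) ^ n * B"
proof (induction n arbitrary: w)
  case (Suc n)
  then show ?case
    using walk_op_bound[of "(walk_op N lam ^^ n) g" "(2 + \<bar>lam\<bar>) ^ n * B" N lam w]
    by (simp add: mult.assoc)
qed (use assms in simp)

lemma walk_moment_bound: "\<bar>walk_moment N lam n\<bar> \<le> 1 * (2 + \<bar>lam\<bar>) ^ n"
  using walk_op_power_bound[where g = vac and B = 1 and N = N and lam = lam and n = n and w = "[]"] by (simp add: vac_def)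

lemma coord_S_op_power:
  assumes "N > 0"
  shows "coord ((S_op N lam ^^ n) \<Omega>) w
    = complex_of_real ((walk_op N lam ^^ n) vac w / sqrt (real N) ^ length w)"
proof (induction n arbitrary: w)
  case 0
  then show ?case by (simp add: coord_ket vac_def)
next
  case (Suc n)
  show ?case
    using coord_S_op_scaled[OF assms Suc.IH] by simp
qed

lemma vacuum_state_S_op_power:
  assumes "N > 0"
  shows "\<phi> (S_op N lam ^^ n) = complex_of_real (walk_moment N lam n)"
  using coord_S_op_power[OF assms, where lam = lam and n = n and w = "[]"]
  by (simp add: vacuum_state_def cinner_ket)

section \<open>The moment series as a resolvent entry\<close>

text \<open>Iterating the equation for \<open>f\<close> gives the partial sums of the Neumann series, with a remainder that
  vanishes because \<open>f\<close> is bounded. So any bounded solution of the resolvent equation computes the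
  moment series.\<close>

lemma resolvent_sums:
  assumes f: "\<And>w. f w = vac w + x * walk_op N lam f w"
    and bounded: "\<And>w. \<bar>f w\<bar> \<le> B"
    and x: "0 < x" "(2 + \<bar>lam\<bar>) * x < 1"
  shows "(\<lambda>n. walk_moment N lam n * x ^ n) sums f []"
proof -
  define T where "T = walk_op N lam"
  have iter: "f w = (\<Sum>k<n. x ^ k * (T ^^ k) vac w) + x ^ n * (T ^^ n) f w" for n w
  proof (induction n arbitrary: w)
    case (Suc n)
    then have "f = (\<lambda>w. (\<Sum>k<n. x ^ k * (T ^^ k) vac w) + x ^ n * (T ^^ n) f w)"
      by blast
    then have "T f w = T (\<lambda>w. (\<Sum>k<n. x ^ k * (T ^^ k) vac w) + x ^ n * (T ^^ n) f w) w"
      by (rule arg_cong)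
    also have "\<dots> = (\<Sum>k<n. x ^ k * (T ^^ Suc k) vac w) + x ^ n * (T ^^ Suc n) f w"
      unfolding T_def by (simp add: walk_op_combination)
    finally have "f w = vac w + x * ((\<Sum>k<n. x ^ k * (T ^^ Suc k) vac w) + x ^ n * (T ^^ Suc n) f w)"
      using f[of w] by (simp add: T_def)
    then show ?case
      by (simp add: sum.lessThan_Suc_shift sum_distrib_left algebra_simps del: sum.lessThan_Suc)
  qed simp
  have "(\<lambda>n. x ^ n * (T ^^ n) f []) \<longlonglongrightarrow> 0"
  proof (rule Lim_null_comparison)
    have "norm (x ^ n * (T ^^ n) f []) \<le> ((2 + \<bar>lam\<bar>) * x) ^ n * B" for n
      using x mult_left_mono[OF walk_op_power_bound[OF bounded,
            where N = N and lam = lam and n = n and w = "[]"], of "x ^ n"]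
      by (simp add: T_def abs_mult power_mult_distrib mult_ac)
    then show "\<forall>\<^sub>F n in sequentially. norm (x ^ n * (T ^^ n) f []) \<le> ((2 + \<bar>lam\<bar>) * x) ^ n * B"
      by simp
    show "(\<lambda>n. ((2 + \<bar>lam\<bar>) * x) ^ n * B) \<longlonglongrightarrow> 0"
      using x by (intro tendsto_mult_left_zero LIMSEQ_realpow_zero) auto
  qed
  then have "(\<lambda>n. f [] - x ^ n * (T ^^ n) f []) \<longlonglongrightarrow> f [] - 0"
    by (intro tendsto_diff tendsto_const)
  moreover have "f [] - x ^ n * (T ^^ n) f [] = (\<Sum>k<n. walk_moment N lam k * x ^ k)" for n
    using iter[of "[]" n] by (simp add: T_def mult.commute)
  ultimately show ?thesis
    by (simp add: sums_def)
qed

section \<open>The resolvent on the tree of V-words\<close>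

text \<open>The assumption keeps all quantities below at least \<open>1 / 2\<close>: each of them is \<open>a\<close> minus at most \<open>N\<close>
  terms of size at most \<open>2 * h\<close>, where \<open>h * N = x\<^sup>2\<close>.\<close>

locale V_tree =
  fixes N :: nat and a x :: real
  assumes N: "0 < N" and small: "1 / 2 + 2 * x\<^sup>2 \<le> a"
begin

definition h :: real where "h = x\<^sup>2 / real N"

text \<open>\<open>E\<close> is determined from the largest letter downwards, since a word that is not rising can only be
  extended by larger letters. The recursion therefore runs over \<open>j = N - i\<close>.\<close>

primrec falling_from_top :: "nat \<Rightarrow> real" where
  "falling_from_top 0 = a"
| "falling_from_top (Suc j) = falling_from_top j - h / falling_from_top j"

definition E :: "nat \<Rightarrow> real" where "E i = falling_from_top (N - i)"

text \<open>\<open>W i\<close> is \<open>a\<close> minus \<open>h\<close> times the sum of \<open>1 / V k\<close> over \<open>k \<le> i\<close> and of \<open>1 / E k\<close> over \<open>k > i\<close>; in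
  \<open>V i\<close>, the letter \<open>i\<close> itself is left out. It interpolates between \<open>E 0\<close> at \<open>i = 0\<close> and the value
  at \<open>i = N\<close> that determines the root entry.\<close>

primrec W :: "nat \<Rightarrow> real" where
  "W 0 = E 0"
| "W (Suc i) = W i + h / E (Suc i) - h / (W i + h / E (Suc i))"

definition V :: "nat \<Rightarrow> real" where "V i = W (i - 1) + h / E i"

lemma h_bounds: "0 \<le> h" "h * real N = x\<^sup>2"
  using N by (auto simp: h_def)

lemma h_le: "j \<le> N \<Longrightarrow> h * real j \<le> x\<^sup>2"
  using mult_left_mono[of "real j" "real N" h] h_bounds by simp

lemma h_div_le: "1 / 2 \<le> y \<Longrightarrow> h / y \<le> 2 * h"
  using h_bounds(1) mult_left_mono[of 1 "2 * y" h] by (simp add: pos_divide_le_eq mult_ac)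

lemma E_top: "E N = a"
  by (simp add: E_def)

lemma E_step: "i < N \<Longrightarrow> E i = E (Suc i) - h / E (Suc i)"
  unfolding E_def by (subst Suc_diff_Suc[symmetric]) simp_all

lemma E_lower: "i \<le> N \<Longrightarrow> a - 2 * (h * real (N - i)) \<le> E i"
proof -
  have "a - 2 * (h * real j) \<le> falling_from_top j" if "j \<le> N" for j
    using that
  proof (induction j)
    case (Suc j)
    have "1 / 2 \<le> falling_from_top j"
      using Suc h_le[of j] small by simp
    then show ?case
      using Suc h_div_le[of "falling_from_top j"] by (simp add: distrib_left)
  qed simp
  then show ?thesis by (simp add: E_def)
qed

lemma E_ge: "i \<le> N \<Longrightarrow> 1 / 2 \<le> E i"
  using E_lower[of i] h_le[of "N - i"] small by simp

text \<open>The bounds \<open>1 / 2 \<le> W\<close> and \<open>W \<ge> E - \<dots>\<close> support each other: the step from \<open>W i\<close> to \<open>W (Suc i)\<close>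
  adds the increment of \<open>E\<close> and subtracts \<open>h / V (Suc i)\<close>, which is at most \<open>2 * h\<close> as long as \<open>W i\<close>
  is not small.\<close>

lemma W_lower: "i \<le> N \<Longrightarrow> E i - 2 * (h * real i) \<le> W i"
  and W_ge: "i \<le> N \<Longrightarrow> 1 / 2 \<le> W i"
proof -
  have ge: "1 / 2 \<le> W i" if "i \<le> N" "E i - 2 * (h * real i) \<le> W i" for i
  proof -
    have "h * real (N - i) + h * real i = x\<^sup>2"
      using that(1) h_bounds(2) by (simp flip: distrib_left of_nat_add)
    then show ?thesis
      using that(2) E_lower[OF that(1)] small by linarith
  qed
  show W: "E i - 2 * (h * real i) \<le> W i" if "i \<le> N" for i
    using that
  proof (induction i)
    case (Suc i)
    have "0 \<le> h / E (Suc i)"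
      using h_bounds(1) E_ge[OF Suc.prems] by simp
    then have "h / (W i + h / E (Suc i)) \<le> 2 * h"
      using Suc.IH Suc.prems ge[of i] by (intro h_div_le) linarith
    then show ?case
      using Suc E_step[of i] by (simp add: distrib_left)
  qed simp
  show "1 / 2 \<le> W i" if "i \<le> N"
    using ge that W by blast
qed

lemma V_ge: "i \<in> {1..N} \<Longrightarrow> 1 / 2 \<le> V i"
proof -
  assume "i \<in> {1..N}"
  then have "1 / 2 \<le> W (i - 1)" and E: "1 / 2 \<le> E i"
    by (simp_all only: W_ge E_ge atLeastAtMost_iff le_diff_conv trans_le_add1)
  moreover have "0 \<le> h / E i"
    using h_bounds(1) E by simp
  ultimately show ?thesis
    unfolding V_def by linarith
qed

lemma W_step: "W (Suc i) = V (Suc i) - h / V (Suc i)"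
  by (simp add: V_def)

lemma E_sum: "i \<le> N \<Longrightarrow> E i = a - h * (\<Sum>k\<in>{i<..N}. 1 / E k)"
proof (induction i rule: inc_induct)
  case base
  then show ?case by (simp add: E_top)
next
  case (step i)
  have "{i<..N} = insert (Suc i) {Suc i<..N}"
    using step.hyps by auto
  then show ?case
    using step.hyps step.IH E_step[of i] by (simp add: distrib_left)
qed

lemma W_sum: "i \<le> N \<Longrightarrow> W i = E i - h * (\<Sum>k=1..i. 1 / V k)"
proof (induction i)
  case (Suc i)
  have "V (Suc i) = W i + h / E (Suc i)"
    by (simp add: V_def)
  moreover have "W i = E i - h * (\<Sum>k=1..i. 1 / V k)" "E i = E (Suc i) - h / E (Suc i)"
    using Suc E_step by simp_all
  moreover have "h * (\<Sum>k=1..Suc i. 1 / V k) = h * (\<Sum>k=1..i. 1 / V k) + h / V (Suc i)"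
    by (simp add: distrib_left)
  ultimately show ?case
    unfolding W_step by linarith
qed simp

lemma V_sum: "i \<in> {1..N} \<Longrightarrow> V i = E i - h * (\<Sum>k\<in>{1..<i}. 1 / V k)"
proof -
  assume i: "i \<in> {1..N}"
  then obtain j where j: "i = Suc j" by (cases i) auto
  have "{1..<i} = {1..j}" using j by auto
  then have "W j = E j - h * (\<Sum>k\<in>{1..<i}. 1 / V k)"
    using i j W_sum[of j] by simp
  moreover have "V i = W j + h / E i" by (simp add: V_def j)
  moreover have "E j = E i - h / E i" using i j E_step[of j] by simp
  ultimately show ?thesis by linarith
qed

text \<open>The resolvent entry of the subtree above a nonempty V-word \<open>w\<close>, taken at \<open>w\<close> itself.\<close>

definition subtree_green :: "nat list \<Rightarrow> real" where
  "subtree_green w = (if sorted_wrt (<) w then 1 / V (hd w) else 1 / E (hd w))"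

text \<open>The column of the resolvent at the vacuum. On a tree it is a product over the path from the root:
  each step contributes \<open>x\<close> and the resolvent of the subtree that is entered.\<close>

primrec green :: "nat list \<Rightarrow> real" where
  "green [] = 1 / (1 - a + W N)"
| "green (i # w) = (if V_word (i # w) \<and> i \<in> {1..N} then x * subtree_green (i # w) * green w else 0)"

text \<open>Above a rising word starting with \<open>j\<close> sit the rising words with first letter below \<open>j\<close> and words
  with a descent and first letter above \<open>j\<close>.\<close>

lemma children_sum_rising:
  assumes j: "j \<in> {1..N}" and v: "sorted_wrt (<) (j # v)"
  shows "a - h * (\<Sum>i=1..N. if V_word (i # j # v) then subtree_green (i # j # v) else 0) = V j"
proof -
  have rising: "sorted_wrt (<) (i # j # v) \<longleftrightarrow> i < j" for i
    using v by (simp only: sorted_wrt2[OF transp_on_less] simp_thms)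
  have summand: "(if V_word (i # j # v) then subtree_green (i # j # v) else 0)
      = (if i = j then 0 else if i < j then 1 / V i else 1 / E i)" for i
    unfolding V_word_Cons_rising[OF v] subtree_green_def rising list.sel by simp
  have "(\<Sum>i=1..N. if V_word (i # j # v) then subtree_green (i # j # v) else 0)
      = (\<Sum>i\<in>{1..<j} \<union> {j<..N}. if i = j then 0 else if i < j then 1 / V i else 1 / E i)"
    unfolding summand by (rule sum.mono_neutral_right) (use j in auto)
  also have "\<dots> = (\<Sum>i\<in>{1..<j}. if i = j then 0 else if i < j then 1 / V i else 1 / E i)
        + (\<Sum>i\<in>{j<..N}. if i = j then 0 else if i < j then 1 / V i else 1 / E i)"
    by (rule sum.union_disjoint) auto
  also have "\<dots> = (\<Sum>i\<in>{1..<j}. 1 / V i) + (\<Sum>i\<in>{j<..N}. 1 / E i)"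
    by (rule arg_cong2[where f = "(+)"]; rule sum.cong) auto
  finally show ?thesis
    using j V_sum[OF j] E_sum[of j] by (simp add: distrib_left)
qed

lemma children_sum_falling:
  assumes j: "j \<in> {1..N}" and v: "V_word (j # v)" "\<not> sorted_wrt (<) (j # v)"
  shows "a - h * (\<Sum>i=1..N. if V_word (i # j # v) then subtree_green (i # j # v) else 0) = E j"
proof -
  have "\<not> sorted_wrt (<) (i # j # v)" for i
    using v(2) by (simp only: sorted_wrt2[OF transp_on_less] simp_thms)
  then have summand: "(if V_word (i # j # v) then subtree_green (i # j # v) else 0)
      = (if j < i then 1 / E i else 0)" for i
    by (simp only: V_word_Cons_falling[OF v] subtree_green_def if_False list.sel)
  have "(\<Sum>i=1..N. if V_word (i # j # v) then subtree_green (i # j # v) else 0)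
      = (\<Sum>i\<in>{j<..N}. 1 / E i)"
    unfolding summand by (rule sum.mono_neutral_cong_right) (use j in auto)
  then show ?thesis
    using j E_sum[of j] by simp
qed

text \<open>The continued fraction equation, with both kinds of vertices treated alike.\<close>

lemma subtree_green_inverse:
  assumes w: "V_word (j # v)" and j: "j \<in> {1..N}"
  shows "subtree_green (j # v)
      * (a - h * (\<Sum>i=1..N. if V_word (i # j # v) then subtree_green (i # j # v) else 0)) = 1"
proof (cases "sorted_wrt (<) (j # v)")
  case True
  have "V j \<noteq> 0" using V_ge[OF j] by auto
  moreover have "subtree_green (j # v) = 1 / V j"
    using True by (simp add: subtree_green_def)
  ultimately show ?thesis
    unfolding children_sum_rising[OF j True] by simp
next
  case False
  have "E j \<noteq> 0" using E_ge[of j] j by auto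
  moreover have "subtree_green (j # v) = 1 / E j"
    using False by (simp only: subtree_green_def if_False list.sel)
  ultimately show ?thesis
    unfolding children_sum_falling[OF j w False] by simp
qed

lemma average_children:
  "x * ((\<Sum>i=1..N. green (i # w)) / real N)
    = h * (\<Sum>i=1..N. if V_word (i # w) then subtree_green (i # w) else 0) * green w"
proof -
  have "(\<Sum>i=1..N. green (i # w))
      = x * (\<Sum>i=1..N. if V_word (i # w) then subtree_green (i # w) else 0) * green w"
    unfolding sum_distrib_left sum_distrib_right by (intro sum.cong) auto
  then show ?thesis
    by (simp add: h_def power2_eq_square)
qed

text \<open>At a vertex other than the root, the terms for the vertex and its children combine to
  \<open>(1 - (a - h * S)) * green w\<close>, where \<open>a - h * S\<close> is the reciprocal of \<open>subtree_green w\<close>; so what is left of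
  \<open>green w\<close> is exactly \<open>x\<close> times the value at the parent.\<close>

lemma green_equation:
  assumes lam: "lam * x = 1 - a" and root: "1 - a + W N \<noteq> 0"
  shows "green w = vac w + x * walk_op N lam green w"
proof (cases w)
  case Nil
  have "(\<Sum>i=1..N. if V_word [i] then subtree_green [i] else 0) = (\<Sum>i=1..N. 1 / V i)"
    by (simp add: V_word_increasing subtree_green_def)
  then have "x * walk_op N lam green [] = h * (\<Sum>i=1..N. 1 / V i) * green []"
    using average_children[of "[]"] by (simp add: walk_op_def)
  also have "h * (\<Sum>i=1..N. 1 / V i) = 1 - (1 - a + W N)"
    using W_sum[of N] E_top by simp
  also have "(1 - (1 - a + W N)) * green [] = green [] - 1"
    using root by (simp add: field_simps)
  finally show ?thesis by (simp add: Nil vac_def)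
next
  case (Cons j v)
  show ?thesis
  proof (cases "V_word w \<and> j \<in> {1..N}")
    case False
    then have w: "green w = 0" by (auto simp: Cons)
    then have "green (i # w) = 0" for i by simp
    then have "walk_op N lam green w = 0"
      using False by (auto simp: walk_op_def Cons simp del: green.simps)
    then show ?thesis
      using w by (simp add: vac_def Cons del: green.simps)
  next
    case True
    define S where "S = (\<Sum>i=1..N. if V_word (i # w) then subtree_green (i # w) else 0)"
    have "(a - h * S) * green w = x * (subtree_green w * (a - h * S)) * green v"
      using True by (simp add: Cons)
    also have "subtree_green w * (a - h * S) = 1"
      using True subtree_green_inverse[of j v] unfolding S_def Cons by blast
    finally have "x * green v = (a - h * S) * green w" by simp
    moreover have "x * walk_op N lam green w
        = x * green v + lam * x * green w + x * ((\<Sum>i=1..N. green (i # w)) / real N)"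
      using True by (simp add: walk_op_def Cons distrib_left del: green.simps)
    moreover have "x * ((\<Sum>i=1..N. green (i # w)) / real N) = h * S * green w"
      using average_children[of w] by (simp add: S_def)
    ultimately show ?thesis
      unfolding lam by (simp add: Cons vac_def algebra_simps del: green.simps)
  qed
qed

lemma green_bounded:
  assumes "\<bar>x\<bar> \<le> 1 / 2"
  shows "\<bar>green w\<bar> \<le> \<bar>green []\<bar>"
proof (induction w)
  case (Cons i w)
  have "\<bar>x * subtree_green (i # w) * green w\<bar> \<le> 1 / 2 * 2 * \<bar>green []\<bar>" if "i \<in> {1..N}"
  proof -
    have "\<bar>1 / y\<bar> \<le> 2" if "1 / 2 \<le> y" for y :: real
      using that by (simp add: abs_divide field_simps)
    then have "\<bar>subtree_green (i # w)\<bar> \<le> 2"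
      using V_ge[OF that] E_ge[of i] that by (auto simp: subtree_green_def)
    then show ?thesis
      unfolding abs_mult using assms Cons.IH by (intro mult_mono) auto
  qed
  then show ?case by (auto simp del: green.simps(1))
qed simp

lemma walk_moment_sums:
  assumes lam: "lam * x = 1 - a" and x: "0 < x" "(2 + \<bar>lam\<bar>) * x \<le> 1 / 2"
  shows "(\<lambda>n. walk_moment N lam n * x ^ n) sums (1 / (lam * x + W N))"
proof -
  have x2: "2 * x + \<bar>lam * x\<bar> \<le> 1 / 2"
    using x by (simp add: distrib_right abs_mult)
  then have "0 < 1 - a + W N"
    using W_ge[of N] x(1) unfolding lam by linarith
  then have eq: "green w = vac w + x * walk_op N lam green w" for w
    by (intro green_equation[OF lam]) simp
  have "\<bar>x\<bar> \<le> 1 / 2" using x x2 by linarith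
  from resolvent_sums[OF eq green_bounded[OF this] x(1)] x(2) show ?thesis
    by (simp add: lam)
qed

end

section \<open>First integrals of the recursion\<close>

text \<open>One step of the recursion moves \<open>(e, w)\<close> by \<open>(d, d - b)\<close>, where \<open>d = h / e'\<close> and \<open>b = h / (w + d)\<close>.
  On the segment between the two points the derivative of \<open>T0 (w / e) - ln e\<close> is
  \<open>(b * W - d * E) / (W\<^sup>2 - W * E + E\<^sup>2)\<close>. Its numerator would vanish if \<open>b\<close> and \<open>d\<close> were \<open>h / W\<close> and
  \<open>h / E\<close> at the current point, as in the differential equation; since the points of the segment
  are within \<open>O(h)\<close> of each other, it is \<open>O(h\<^sup>2)\<close>.\<close>

lemma first_integral_step:
  fixes e w d b h :: real
  defines "e' \<equiv> e + d" and "w' \<equiv> w + d - b"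
  assumes lower: "1 / 2 \<le> e" "1 / 2 \<le> w" "1 / 2 \<le> w'" and d: "0 \<le> d" "0 \<le> b"
     and h: "0 \<le> h" "d * e' = h" "b * (w + d) = h"
  shows "\<bar>(T0 (w' / e') - ln e') - (T0 (w / e) - ln e)\<bar> \<le> 64 * h\<^sup>2"
proof -
  define E where "E = (\<lambda>s. e + s * d)"
  define W where "W = (\<lambda>s. w + s * (d - b))"
  define Q where "Q = (\<lambda>s. (W s)\<^sup>2 - W s * E s + (E s)\<^sup>2)"
  define \<psi> where "\<psi> = (\<lambda>s. T0 (W s / E s) - ln (E s))"
  have E: "1 / 2 \<le> E s" if "0 \<le> s" for s
    using that lower d by (simp add: E_def add_increasing2)
  have Q: "3 / 16 \<le> Q s" if "0 \<le> s" for s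
  proof -
    have "Q s = (W s - E s / 2)\<^sup>2 + 3 / 4 * (E s)\<^sup>2"
      by (simp add: Q_def power2_eq_square algebra_simps)
    moreover have "1 / 4 \<le> (E s)\<^sup>2"
      using power_mono[of "1 / 2" "E s" 2] E[OF that] by (simp add: power_one_over)
    ultimately show ?thesis
      using zero_le_power2[of "W s - E s / 2"] by linarith
  qed
  have der: "(\<psi> has_real_derivative (b * W s - d * E s) / Q s) (at s)" if "0 \<le> s" for s
  proof -
    have dv: "((\<lambda>s. W s / E s) has_real_derivative ((d - b) * E s - W s * d) / (E s)\<^sup>2) (at s)"
      using E[OF that] unfolding W_def E_def
      by (auto intro!: derivative_eq_intros simp: power2_eq_square)
    have dl: "((\<lambda>s. ln (E s)) has_real_derivative d / E s) (at s)"
      using E[OF that] unfolding E_def by (auto intro!: derivative_eq_intros)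
    have "(\<psi> has_real_derivative
        - (W s / E s / ((W s / E s)\<^sup>2 - W s / E s + 1)) * (((d - b) * E s - W s * d) / (E s)\<^sup>2)
          - d / E s) (at s)"
      unfolding \<psi>_def by (intro DERIV_diff dl DERIV_chain2[OF T0_deriv] dv)
    moreover have "- (W s / E s / ((W s / E s)\<^sup>2 - W s / E s + 1)) * (((d - b) * E s - W s * d) / (E s)\<^sup>2)
          - d / E s = (b * W s - d * E s) / Q s"
    proof -
      have E0: "E s \<noteq> 0" and Q0: "Q s \<noteq> 0" using E[OF that] Q[OF that] by auto
      have q: "(W s / E s)\<^sup>2 - W s / E s + 1 = Q s / (E s)\<^sup>2"
        using E0 by (simp add: Q_def add_divide_distrib diff_divide_distrib power_divide)
          (simp add: power2_eq_square)
      have alg: "- (p / r / (q / r\<^sup>2)) * (n / r\<^sup>2) - d / r = - (p * n + d * q) / (r * q)"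
        if "r \<noteq> 0" "q \<noteq> 0" for p q r n :: real
      proof -
        have "p / r / (q / r\<^sup>2) = p * r / q"
          using that by (simp add: power2_eq_square)
        then show ?thesis using that by (simp add: power2_eq_square field_simps)
      qed
      have "- (W s / E s / ((W s / E s)\<^sup>2 - W s / E s + 1)) * (((d - b) * E s - W s * d) / (E s)\<^sup>2)
          - d / E s = - (W s * ((d - b) * E s - W s * d) + d * Q s) / (E s * Q s)"
        unfolding q by (rule alg[OF E0 Q0])
      also have "W s * ((d - b) * E s - W s * d) + d * Q s = - (b * W s - d * E s) * E s"
        by (simp add: Q_def power2_eq_square algebra_simps)
      also have "- (- (b * W s - d * E s) * E s) / (E s * Q s) = (b * W s - d * E s) / Q s"
        using E0 by (simp add: minus_divide_left)
      finally show ?thesis .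
    qed
    ultimately show ?thesis by (rule DERIV_cong)
  qed
  have "\<exists>s>0. s < 1 \<and> \<psi> 1 - \<psi> 0 = (1 - 0) * ((b * W s - d * E s) / Q s)"
    by (rule MVT2) (simp, erule der)
  then obtain s where s: "0 < s" "s < 1" "\<psi> 1 - \<psi> 0 = (b * W s - d * E s) / Q s"
    by auto
  have dh: "d \<le> 2 * h" and bh: "b \<le> 2 * h"
    using h d lower mult_left_mono[of "1 / 2" e' d] mult_left_mono[of "1 / 2" "w + d" b]
    by (auto simp: e'_def)
  have "b * W s - d * E s = b * (W s - (w + d)) + d * (e' - E s)"
    using h by (simp add: algebra_simps)
  also have "\<bar>\<dots>\<bar> \<le> b * \<bar>W s - (w + d)\<bar> + d * \<bar>e' - E s\<bar>"
    using d abs_triangle_ineq[of "b * (W s - (w + d))" "d * (e' - E s)"] by (simp add: abs_mult)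
  also have "\<dots> \<le> b * (2 * (2 * h)) + d * (2 * h)"
  proof -
    have "e' - E s = (1 - s) * d" "W s - (w + d) = - (1 - s) * d - s * b"
      by (simp_all add: e'_def E_def W_def algebra_simps)
    moreover have "0 \<le> (1 - s) * d" "(1 - s) * d \<le> d" "0 \<le> s * b" "s * b \<le> b"
      using s d by (auto simp: mult_left_le_one_le)
    ultimately show ?thesis
      using d dh bh by (intro add_mono mult_left_mono) linarith+
  qed
  also have "\<dots> \<le> 2 * h * (2 * (2 * h)) + 2 * h * (2 * h)"
    using d dh bh h by (intro add_mono mult_right_mono) auto
  finally have num: "\<bar>b * W s - d * E s\<bar> \<le> 12 * h\<^sup>2"
    by (simp add: power2_eq_square)
  have "\<bar>(b * W s - d * E s) / Q s\<bar> \<le> 12 * h\<^sup>2 / (3 / 16)"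
    unfolding abs_divide using num Q[of s] s by (intro frac_le) auto
  also have "\<dots> = 64 * h\<^sup>2" by simp
  finally have "\<bar>\<psi> 1 - \<psi> 0\<bar> \<le> 64 * h\<^sup>2"
    by (simp only: s(3))
  moreover have "\<psi> 1 - \<psi> 0 = (T0 (w' / e') - ln e') - (T0 (w / e) - ln e)"
    by (simp add: \<psi>_def E_def W_def e'_def w'_def add_diff_eq)
  ultimately show ?thesis by (simp only:)
qed

context V_tree
begin

lemma h_square_times_N: "h\<^sup>2 * real N = x ^ 4 / real N"
  using N by (simp add: h_def power2_eq_square power4_eq_xxxx)

text \<open>The cross term in the square of \<open>E i = E (Suc i) - h / E (Suc i)\<close> is exactly \<open>- 2 * h\<close>, so the only
  deviation from the first integral is \<open>(h / E (Suc i))\<^sup>2 \<le> 4 * h\<^sup>2\<close>.\<close>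

lemma E_square_drift: "\<bar>(E 0)\<^sup>2 - (a\<^sup>2 - 2 * x\<^sup>2)\<bar> \<le> 4 * x ^ 4 / real N"
proof -
  have "\<bar>(E i)\<^sup>2 - (a\<^sup>2 - 2 * h * real (N - i))\<bar> \<le> 4 * h\<^sup>2 * real (N - i)" if "i \<le> N" for i
    using that
  proof (induction i rule: inc_induct)
    case base
    then show ?case by (simp add: E_top)
  next
    case (step i)
    have "E (Suc i) \<noteq> 0" using E_ge[of "Suc i"] step by auto
    then have "(E i)\<^sup>2 = (E (Suc i))\<^sup>2 - 2 * h + (h / E (Suc i))\<^sup>2"
      using step by (simp add: E_step power2_diff)
    moreover have "(h / E (Suc i))\<^sup>2 \<le> (2 * h)\<^sup>2"
      using step E_ge[of "Suc i"] h_bounds(1) by (intro power_mono h_div_le) auto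
    moreover have "0 \<le> (h / E (Suc i))\<^sup>2" by simp
    moreover have "(2 * h)\<^sup>2 = 4 * h\<^sup>2"
      by (simp add: power_mult_distrib)
    moreover have i: "real (N - i) = real (N - Suc i) + 1"
      using step by linarith
    have "2 * h * real (N - i) = 2 * h * real (N - Suc i) + 2 * h"
      "4 * h\<^sup>2 * real (N - i) = 4 * h\<^sup>2 * real (N - Suc i) + 4 * h\<^sup>2"
      unfolding i by (simp_all add: distrib_left)
    ultimately show ?case
      using step.IH unfolding abs_le_iff by linarith
  qed
  from this[of 0] show ?thesis
    using h_bounds(2) h_square_times_N by (simp add: mult.assoc)
qed

lemma first_integral_drift:
  "\<bar>T0 (W N / a) - (ln a - ln (E 0))\<bar> \<le> 64 * x ^ 4 / real N"
proof -
  have "\<bar>(T0 (W i / E i) - ln (E i)) - (T0 1 - ln (E 0))\<bar> \<le> 64 * h\<^sup>2 * real i" if "i \<le> N" for i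
    using that
  proof (induction i)
    case 0
    then show ?case using E_ge[of 0] by auto
  next
    case (Suc i)
    define d where "d = h / E (Suc i)"
    define b where "b = h / V (Suc i)"
    have ge: "1 / 2 \<le> E i" "1 / 2 \<le> E (Suc i)" "1 / 2 \<le> V (Suc i)"
      "1 / 2 \<le> W i" "1 / 2 \<le> W (Suc i)"
      using Suc.prems E_ge[of i] E_ge[of "Suc i"] V_ge[of "Suc i"] W_ge[of i] W_ge[of "Suc i"]
      by auto
    have E': "E i + d = E (Suc i)" and V': "W i + d = V (Suc i)"
      and W': "W i + d - b = W (Suc i)"
      using Suc.prems by (simp_all add: E_step d_def b_def V_def)
    have "d * E (Suc i) = h" "b * (W i + d) = h" "0 \<le> d" "0 \<le> b"
      unfolding V' using ge h_bounds(1) by (auto simp: d_def b_def)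
    then have "\<bar>(T0 ((W i + d - b) / (E i + d)) - ln (E i + d)) - (T0 (W i / E i) - ln (E i))\<bar>
        \<le> 64 * h\<^sup>2"
      using ge h_bounds(1) by (intro first_integral_step) (simp_all only: E' W')
    then have "\<bar>(T0 (W (Suc i) / E (Suc i)) - ln (E (Suc i))) - (T0 (W i / E i) - ln (E i))\<bar>
        \<le> 64 * h\<^sup>2"
      by (simp only: E' W')
    moreover have "64 * h\<^sup>2 * real (Suc i) = 64 * h\<^sup>2 * real i + 64 * h\<^sup>2"
      by (simp add: distrib_left)
    moreover have "\<bar>(T0 (W i / E i) - ln (E i)) - (T0 1 - ln (E 0))\<bar> \<le> 64 * h\<^sup>2 * real i"
      using Suc by simp
    ultimately show ?case by linarith
  qed
  from this[of N] show ?thesis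
    using h_square_times_N by (simp add: E_top T0_1 mult.assoc)
qed

end

section \<open>Coefficients from values of power series\<close>

lemma power_series_term_le:
  fixes c :: "nat \<Rightarrow> real"
  assumes "\<bar>c n\<bar> \<le> B * C ^ n" "0 < x"
  shows "norm (c n * x ^ n) \<le> B * (C * x) ^ n"
proof -
  have "norm (c n * x ^ n) = \<bar>c n\<bar> * x ^ n"
    using assms by (simp add: abs_mult)
  also have "\<dots> \<le> B * C ^ n * x ^ n"
    using assms by (intro mult_right_mono) auto
  finally show ?thesis by (simp add: power_mult_distrib mult.assoc)
qed

text \<open>Here \<open>C * x \<le> 1 / 2\<close> makes the geometric tail at most twice its first term.\<close>

lemma power_series_minus_const_le:
  fixes c :: "nat \<Rightarrow> real"
  assumes c: "\<And>n. \<bar>c n\<bar> \<le> B * C ^ n" and "0 \<le> C" and x: "0 < x" "C * x \<le> 1 / 2"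
  shows "summable (\<lambda>n. c n * x ^ n)" "\<bar>(\<Sum>n. c n * x ^ n) - c 0\<bar> \<le> 2 * B * C * x"
proof -
  have B: "0 \<le> B" using c[of 0] by simp
  have Cx: "0 \<le> C * x" using assms by simp
  have le: "norm (c n * x ^ n) \<le> B * (C * x) ^ n" for n
    using c x(1) by (rule power_series_term_le)
  have geo: "summable (\<lambda>n. B * (C * x) ^ n)"
    using Cx x by (intro summable_mult summable_geometric) auto
  show s: "summable (\<lambda>n. c n * x ^ n)"
    by (rule summable_comparison_test'[OF geo le])
  have "(\<Sum>n. c n * x ^ n) - c 0 = (\<Sum>n. c (Suc n) * x ^ Suc n)"
    using suminf_split_head[OF s] by simp
  also have "norm \<dots> \<le> (\<Sum>n. B * (C * x) ^ Suc n)"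
    using summable_ignore_initial_segment[OF geo, of 1] by (intro norm_suminf_le le) simp
  also have "\<dots> = B * (C * x) * (1 / (1 - C * x))"
    using Cx x suminf_mult[OF summable_geometric[of "C * x"], of "B * (C * x)"]
    by (simp add: suminf_geometric mult.assoc)
  also have "\<dots> \<le> B * (C * x) * 2"
    using Cx x B by (intro mult_left_mono) (auto simp: field_simps)
  finally show "\<bar>(\<Sum>n. c n * x ^ n) - c 0\<bar> \<le> 2 * B * C * x"
    by (simp add: mult_ac)
qed

lemma convergent_if_uniformly_approximable:
  fixes u :: "nat \<Rightarrow> real"
  assumes "\<And>e. e > 0 \<Longrightarrow> \<exists>v. convergent v \<and> (\<forall>N. \<bar>v N - u N\<bar> \<le> e)"
  shows "convergent u"
proof -
  have "Cauchy u"
  proof (rule metric_CauchyI)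
    fix e :: real assume "0 < e"
    then obtain v where v: "convergent v" "\<And>N. \<bar>v N - u N\<bar> \<le> e / 4"
      using assms[of "e / 4"] by auto
    then obtain M where M: "\<And>m n. m \<ge> M \<Longrightarrow> n \<ge> M \<Longrightarrow> dist (v m) (v n) < e / 4"
      using \<open>0 < e\<close> metric_CauchyD[OF convergent_Cauchy[OF v(1)], of "e / 4"] by auto
    have "dist (u m) (u n) < e" if "m \<ge> M" "n \<ge> M" for m n
      using M[OF that] v(2)[of m] v(2)[of n] \<open>0 < e\<close> unfolding dist_real_def by linarith
    then show "\<exists>M. \<forall>m\<ge>M. \<forall>n\<ge>M. dist (u m) (u n) < e" by blast
  qed
  then show ?thesis by (simp add: Cauchy_convergent_iff)
qed

text \<open>At small \<open>x\<close> the series is close to its constant term, uniformly in \<open>N\<close> by the common bound on the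
  coefficients. So the constant terms are uniformly approximated by convergent sequences.\<close>

lemma constant_terms_convergent:
  fixes c :: "nat \<Rightarrow> nat \<Rightarrow> real"
  assumes c: "\<And>N n. \<bar>c N n\<bar> \<le> B * C ^ n" and C: "0 \<le> C" "0 < r" "C * r \<le> 1 / 2"
    and conv: "\<And>x. 0 < x \<Longrightarrow> x < r \<Longrightarrow> convergent (\<lambda>N. \<Sum>n. c N n * x ^ n)"
  shows "convergent (\<lambda>N. c N 0)"
proof (rule convergent_if_uniformly_approximable)
  fix e :: real assume "0 < e"
  define x where "x = min (r / 2) (e / (2 * B * C + 1))"
  have B: "0 \<le> B" using c[of 0 0] by simp
  then have pos: "0 < 2 * B * C + 1" using C(1) by (simp add: add_nonneg_pos)
  then have x: "0 < x" "x < r"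
    using C(2) \<open>0 < e\<close> by (auto simp: x_def)
  have "(2 * B * C + 1) * x \<le> (2 * B * C + 1) * (e / (2 * B * C + 1))"
    using pos by (intro mult_left_mono) (auto simp: x_def)
  also have "\<dots> = e" using pos by simp
  finally have "2 * B * C * x \<le> e"
    using x(1) by (simp add: distrib_right)
  moreover have "C * x \<le> 1 / 2"
    using C x by (meson less_imp_le mult_left_mono order_trans)
  ultimately have "\<bar>(\<Sum>n. c N n * x ^ n) - c N 0\<bar> \<le> e" for N
    using power_series_minus_const_le(2)[where c = "c N", OF c C(1) x(1)] by simp
  then show "\<exists>v. convergent v \<and> (\<forall>N. \<bar>v N - c N 0\<bar> \<le> e)"
    using conv[OF x] by blast
qed

text \<open>Having removed the convergent constant term and divided by \<open>x\<close>, the argument for the constant term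
  applies again: the shifted coefficients satisfy the same hypotheses with \<open>B * C\<close> in place of \<open>B\<close>.\<close>

lemma coefficients_convergent:
  fixes c :: "nat \<Rightarrow> nat \<Rightarrow> real"
  assumes "\<And>N n. \<bar>c N n\<bar> \<le> B * C ^ n" "0 \<le> C" "0 < r" "C * r \<le> 1 / 2"
    and "\<And>x. 0 < x \<Longrightarrow> x < r \<Longrightarrow> convergent (\<lambda>N. \<Sum>n. c N n * x ^ n)"
  shows "convergent (\<lambda>N. c N n)"
  using assms
proof (induction n arbitrary: c B)
  case 0
  then show ?case by (rule constant_terms_convergent)
next
  case (Suc n c B)
  have c0: "convergent (\<lambda>N. c N 0)"
    by (rule constant_terms_convergent[OF Suc.prems])
  show ?case
  proof (rule Suc.IH[where c = "\<lambda>N n. c N (Suc n)" and B = "B * C"])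
    show "\<bar>c N (Suc n)\<bar> \<le> B * C * C ^ n" for N n
      using Suc.prems(1)[of N "Suc n"] by (simp add: mult.assoc)
    fix x :: real assume x: "0 < x" "x < r"
    have "C * x \<le> 1 / 2"
      using Suc.prems(2,4) x by (meson less_imp_le mult_left_mono order_trans)
    then have s: "summable (\<lambda>n. c N n * x ^ n)" for N
      by (rule power_series_minus_const_le(1)[OF Suc.prems(1,2) x(1)])
    have "(\<Sum>n. c N (Suc n) * x ^ n) = ((\<Sum>n. c N n * x ^ n) - c N 0) / x" for N
    proof -
      have "summable (\<lambda>n. x * (c N (Suc n) * x ^ n))"
        using s[of N, THEN summable_ignore_initial_segment, of 1] by (simp add: mult_ac)
      then have s': "summable (\<lambda>n. c N (Suc n) * x ^ n)"
        using x by (simp add: summable_cmult_iff)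
      have "(\<Sum>n. c N n * x ^ n) - c N 0 = (\<Sum>n. x * (c N (Suc n) * x ^ n))"
        using suminf_split_head[OF s[of N]] by (simp add: mult_ac)
      also have "\<dots> = x * (\<Sum>n. c N (Suc n) * x ^ n)"
        by (rule suminf_mult[OF s'])
      finally show ?thesis using x by simp
    qed
    then show "convergent (\<lambda>N. \<Sum>n. c N (Suc n) * x ^ n)"
      using convergent_diff[OF Suc.prems(5)[OF x] c0] x
      by (simp add: divide_inverse convergent_mult_const_right_iff)
  qed (use Suc.prems in auto)
qed

lemma power_series_limit:
  fixes c :: "nat \<Rightarrow> nat \<Rightarrow> real"
  assumes c: "\<And>N n. \<bar>c N n\<bar> \<le> B * C ^ n" and C: "0 \<le> C"
    and x: "0 < x" "C * x \<le> 1 / 2"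
    and conv: "\<And>n. (\<lambda>N. c N n) \<longlonglongrightarrow> m n"
    and F: "(\<lambda>N. \<Sum>n. c N n * x ^ n) \<longlonglongrightarrow> F"
  shows "(\<lambda>n. m n * x ^ n) sums F"
proof -
  have m: "\<bar>m n\<bar> \<le> B * C ^ n" for n
    using conv[of n] c by (intro tendsto_upperbound[of "\<lambda>N. \<bar>c N n\<bar>"] tendsto_rabs) auto
  have s: "summable (\<lambda>n. m n * x ^ n)"
    by (rule power_series_minus_const_le(1)[OF m C x])
  have "(\<lambda>N. \<Sum>n. c N n * x ^ n) \<longlonglongrightarrow> (\<Sum>n. m n * x ^ n)"
  proof (rule tannerys_theorem[THEN conjunct2, THEN conjunct2])
    have "norm (c N n * x ^ n) \<le> B * (C * x) ^ n" for N n
      using c x(1) by (rule power_series_term_le)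
    then show "\<forall>\<^sub>F (n, N) in at_top \<times>\<^sub>F sequentially. norm (c N n * x ^ n) \<le> B * (C * x) ^ n"
      by (intro always_eventually) auto
    show "summable (\<lambda>n. B * (C * x) ^ n)"
      using C x by (intro summable_mult summable_geometric) (auto simp: abs_mult)
  qed (auto intro!: tendsto_intros conv)
  then have "F = (\<Sum>n. m n * x ^ n)"
    using F LIMSEQ_unique by blast
  then show ?thesis using s by (simp add: summable_sums)
qed

section \<open>The limit of the moment series\<close>

text \<open>Monotonicity of \<open>T0\<close> suffices to invert the limit: an eventual inequality between the values of
  \<open>T0\<close> is one between the arguments.\<close>

lemma T0_inv_limit:
  assumes v: "\<And>n. 0 \<le> v n" and lim: "(\<lambda>n. T0 (v n)) \<longlonglongrightarrow> L"
  shows "v \<longlonglongrightarrow> T0_inv L"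
proof -
  have "T0 (v n) \<le> sqrt 3 * pi / 9" for n
    using v[of n] T0_range by auto
  then have "L \<le> sqrt 3 * pi / 9"
    using lim by (intro LIMSEQ_le_const2) auto
  then have s: "0 \<le> T0_inv L" "T0 (T0_inv L) = L"
    using T0_T0_inv by auto
  have less: "a < b" if "T0 b < T0 a" "0 \<le> b" for a b
    using that T0_strict_decreasing[of b a] by (cases a b rule: linorder_cases) auto
  show ?thesis
  proof (rule order_tendstoI)
    fix y assume y: "y < T0_inv L"
    show "\<forall>\<^sub>F n in sequentially. y < v n"
    proof (cases "y < 0")
      case True
      then have "y < v n" for n using v[of n] by linarith
      then show ?thesis by simp
    next
      case False
      then have "L < T0 y" using T0_strict_decreasing[of y] y s by force
      then have "\<forall>\<^sub>F n in sequentially. T0 (v n) < T0 y"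
        using lim order_tendstoD(2) by blast
      then show ?thesis by eventually_elim (use less v in blast)
    qed
  next
    fix y assume y: "T0_inv L < y"
    then have "T0 y < L" using T0_strict_decreasing[of "T0_inv L"] s by force
    then have "\<forall>\<^sub>F n in sequentially. T0 y < T0 (v n)"
      using lim order_tendstoD(1) by blast
    then show "\<forall>\<^sub>F n in sequentially. v n < y"
      by eventually_elim (use less s y in force)
  qed
qed

lemma walk_series_limit:
  fixes lam x :: real
  defines "a \<equiv> 1 - lam * x"
  assumes x: "0 < x" "(4 + 4 * \<bar>lam\<bar>) * x < 1"
  defines "s \<equiv> T0_inv (1 / 2 * ln (a\<^sup>2 / (a\<^sup>2 - 2 * x\<^sup>2)))"
  shows "(\<lambda>N. \<Sum>n. walk_moment N lam n * x ^ n) \<longlonglongrightarrow> 1 / (lam * x + a * s)"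
    and "lam * x + a * s \<noteq> 0"
proof -
  have lx: "\<bar>lam * x\<bar> < 1 / 4 - x"
    using x by (simp add: distrib_right abs_mult)
  have a: "3 / 4 \<le> a" using lx x(1) unfolding a_def by linarith
  have x4: "x < 1 / 4" using lx by linarith
  have xx: "x\<^sup>2 \<le> 1 / 16"
    using power_mono[of x "1 / 4" 2] x x4 by (simp add: power_one_over)
  have small: "1 / 2 + 2 * x\<^sup>2 \<le> a" using xx a by linarith
  have tree: "V_tree N a x" if "0 < N" for N
    using that small by unfold_locales
  define q where "q = a\<^sup>2 - 2 * x\<^sup>2"
  have "(3 / 4)\<^sup>2 \<le> a\<^sup>2" using a by (intro power_mono) auto
  then have q: "0 < q" using xx by (simp add: q_def power2_eq_square)
  have small_o: "(\<lambda>N. K / real N) \<longlonglongrightarrow> 0" for K :: real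
    using tendsto_mult[OF tendsto_const[of K] lim_inverse_n] by (simp add: divide_inverse)
  define E0 where "E0 = (\<lambda>N. V_tree.E N a x 0)"
  \<comment> \<open>The ratio \<open>W / E\<close> at the top letter, where \<open>E\<close> is \<open>a\<close>.\<close>
  define v where "v = (\<lambda>N. V_tree.W N a x N / a)"
  have E0: "(\<lambda>N. (E0 N)\<^sup>2) \<longlonglongrightarrow> q"
  proof (rule LIM_zero_cancel, rule Lim_null_comparison[OF _ small_o])
    show "\<forall>\<^sub>F N in sequentially. norm ((E0 N)\<^sup>2 - q) \<le> (4 * x ^ 4) / real N"
      using eventually_gt_at_top[of 0]
      by eventually_elim (use V_tree.E_square_drift[OF tree] in \<open>simp add: E0_def q_def\<close>)
  qed
  have pos: "1 / 2 \<le> E0 N" "1 / 2 \<le> a * v N" if "0 < N" for N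
    using V_tree.E_ge[OF tree[OF that], of 0] V_tree.W_ge[OF tree[OF that], of N] a
    by (auto simp: E0_def v_def)
  have lnE0: "(\<lambda>N. ln a - ln (E0 N)) \<longlonglongrightarrow> ln a - ln q / 2"
  proof -
    have "(\<lambda>N. ln a - ln ((E0 N)\<^sup>2) / 2) \<longlonglongrightarrow> ln a - ln q / 2"
      using q by (intro tendsto_intros E0) auto
    moreover have "ln a - ln ((E0 N)\<^sup>2) / 2 = ln a - ln (E0 N)" if "0 < N" for N
      using pos(1)[OF that] by (simp add: ln_realpow)
    then have "\<forall>\<^sub>F N in sequentially. ln a - ln ((E0 N)\<^sup>2) / 2 = ln a - ln (E0 N)"
      by (rule eventually_mono[OF eventually_gt_at_top])
    ultimately show ?thesis by (rule Lim_transform_eventually)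
  qed
  have "(\<lambda>N. T0 (v N) - (ln a - ln (E0 N))) \<longlonglongrightarrow> 0"
  proof (rule Lim_null_comparison[OF _ small_o])
    show "\<forall>\<^sub>F N in sequentially. norm (T0 (v N) - (ln a - ln (E0 N))) \<le> (64 * x ^ 4) / real N"
      using eventually_gt_at_top[of 0]
      by eventually_elim (use V_tree.first_integral_drift[OF tree] in \<open>simp add: E0_def v_def\<close>)
  qed
  from tendsto_add[OF this lnE0] have "(\<lambda>N. T0 (v N)) \<longlonglongrightarrow> ln a - ln q / 2"
    by simp
  also have "ln a - ln q / 2 = 1 / 2 * ln (a\<^sup>2 / q)"
    using a q by (simp add: ln_div ln_realpow)
  finally have "(\<lambda>N. T0 (v N)) \<longlonglongrightarrow> 1 / 2 * ln (a\<^sup>2 / q)" .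
  \<comment> \<open>Positivity of \<open>v N\<close> is known for \<open>N > 0\<close>, so the limit is taken along the shifted sequence.\<close>
  then have "(\<lambda>N. v (Suc N)) \<longlonglongrightarrow> s"
    unfolding s_def q_def[symmetric]
  proof (intro T0_inv_limit)
    have "0 < a * v (Suc N)" for N using pos(2)[of "Suc N"] by linarith
    then show "0 \<le> v (Suc N)" for N using a by (simp add: zero_less_mult_iff less_imp_le)
  qed (rule LIMSEQ_Suc)
  then have v: "v \<longlonglongrightarrow> s" by (rule LIMSEQ_imp_Suc)
  have as: "1 / 2 \<le> a * s"
    using pos(2) by (intro tendsto_lowerbound[OF tendsto_mult[OF tendsto_const v]]
        eventually_mono[OF eventually_gt_at_top[of 0]]) auto
  then show ne: "lam * x + a * s \<noteq> 0" using lx x(1) by linarith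
  have "(2 + \<bar>lam\<bar>) * x \<le> 1 / 2"
    using lx x(1) x4 by (simp add: distrib_right abs_mult)
  then have "(\<Sum>n. walk_moment N lam n * x ^ n) = 1 / (lam * x + a * v N)" if "0 < N" for N
    using V_tree.walk_moment_sums[OF tree[OF that], of lam] x a
    by (simp add: a_def v_def sums_iff)
  then have "1 / (lam * x + a * v N) = (\<Sum>n. walk_moment N lam n * x ^ n)" if "0 < N" for N
    using that by simp
  then have "\<forall>\<^sub>F N in sequentially. 1 / (lam * x + a * v N) = (\<Sum>n. walk_moment N lam n * x ^ n)"
    by (rule eventually_mono[OF eventually_gt_at_top])
  moreover have "(\<lambda>N. 1 / (lam * x + a * v N)) \<longlonglongrightarrow> 1 / (lam * x + a * s)"
    by (intro tendsto_intros v ne)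
  ultimately show "(\<lambda>N. \<Sum>n. walk_moment N lam n * x ^ n) \<longlonglongrightarrow> 1 / (lam * x + a * s)"
    by (rule Lim_transform_eventually[rotated])
qed

theorem theorem5p10:
  fixes lam :: real
  shows "(\<forall>n. convergent (\<lambda>N. \<phi> (S_op N lam ^^ n))) \<and>
    (\<forall>\<^sub>F x in at_right 0.
       summable (\<lambda>n. limit_moment lam n * complex_of_real x ^ n) \<and>
       1 / moment_gf lam x =
         complex_of_real (lam * x + (1 - lam * x) *
           T0_inv (1 / 2 * ln ((1 - lam * x)\<^sup>2 / ((1 - lam * x)\<^sup>2 - 2 * x\<^sup>2)))))"
proof -
  \<comment> \<open>For \<open>0 < x < r\<close> one has \<open>x + \<bar>lam\<bar> * x < 1 / 4\<close>: then \<open>1 - lam * x\<close> exceeds \<open>3 / 4\<close>, and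
    \<open>(2 + \<bar>lam\<bar>) * x \<le> 1 / 2\<close> gives geometric tails.\<close>
  define r where "r = 1 / (4 + 4 * \<bar>lam\<bar>)"
  have r: "0 < r" "(2 + \<bar>lam\<bar>) * r \<le> 1 / 2"
    by (simp_all add: r_def field_simps add_pos_nonneg)
  have small: "(4 + 4 * \<bar>lam\<bar>) * x < 1" if "x < r" for x
    using that by (simp add: r_def field_simps add_pos_nonneg)
  have "convergent (\<lambda>N. walk_moment N lam n)" for n
    using walk_moment_bound _ r
    by (rule coefficients_convergent) (use walk_series_limit(1) small in \<open>auto simp: convergent_def\<close>)
  then obtain m where m: "\<And>n. (\<lambda>N. walk_moment N lam n) \<longlonglongrightarrow> m n"
    unfolding convergent_def by metis
  have state: "(\<lambda>N. \<phi> (S_op N lam ^^ n)) \<longlonglongrightarrow> complex_of_real (m n)" for n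
  proof (rule Lim_transform_eventually)
    show "\<forall>\<^sub>F N in sequentially. complex_of_real (walk_moment N lam n) = \<phi> (S_op N lam ^^ n)"
      using eventually_gt_at_top[of 0] by eventually_elim (simp add: vacuum_state_S_op_power)
  qed (intro tendsto_of_real m)
  then have moment: "limit_moment lam n = complex_of_real (m n)" for n
    unfolding limit_moment_def by (rule limI)
  show ?thesis
  proof (intro conjI allI)
    show "convergent (\<lambda>N. \<phi> (S_op N lam ^^ n))" for n
      using state convergent_def by blast
    have "\<forall>\<^sub>F x in at_right 0. x \<in> {0<..<r}"
      using r(1) by (rule eventually_at_right_real)
    then show "\<forall>\<^sub>F x in at_right 0.
       summable (\<lambda>n. limit_moment lam n * complex_of_real x ^ n) \<and>
       1 / moment_gf lam x =
         complex_of_real (lam * x + (1 - lam * x) *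
           T0_inv (1 / 2 * ln ((1 - lam * x)\<^sup>2 / ((1 - lam * x)\<^sup>2 - 2 * x\<^sup>2))))"
    proof eventually_elim
      case (elim x)
      define D where "D = lam * x + (1 - lam * x) *
           T0_inv (1 / 2 * ln ((1 - lam * x)\<^sup>2 / ((1 - lam * x)\<^sup>2 - 2 * x\<^sup>2)))"
      have x: "0 < x" "x < r" using elim by auto
      have "(2 + \<bar>lam\<bar>) * x \<le> 1 / 2"
        using mult_left_mono[of x r "2 + \<bar>lam\<bar>"] x r(2) by simp
      then have "(\<lambda>n. m n * x ^ n) sums (1 / D)"
        using x(1) walk_series_limit(1)[OF x(1) small[OF x(2)]] unfolding D_def
        by (intro power_series_limit[OF walk_moment_bound _ _ _ m]) auto
      then have "(\<lambda>n. complex_of_real (m n * x ^ n)) sums complex_of_real (1 / D)"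
        by (rule sums_of_real)
      then have "(\<lambda>n. limit_moment lam n * complex_of_real x ^ n) sums complex_of_real (1 / D)"
        by (simp add: moment)
      then show ?case
        unfolding moment_gf_def D_def[symmetric] by (auto simp: sums_iff)
    qed
  qed
qed

end
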